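(* For infinite time Turing machines, $\mathrm{P}\neq\mathrm{NP}\cap\mathrm{co}\text{-}\mathrm{NP}$; in particular $\mathrm{P}\neq\mathrm{NP}$.
   Context: $\mathbb{R}=2^\omega$. Infinite time Turing machines (ITTMs): three binary tapes indexed by $\omega$, finite program with start, limit, halt states; ordinary Turing operation at successor stages; at limit stages the limit state is entered, the head returns to the leftmost cell, and each cell takes the $\limsup$ of its earlier values. A set $A\subseteq\mathbb{R}$ is in $\mathrm{P}$ if there are a program $p$ and $n\in\omega$ such that $p$ decides $A$ and halts on every input in fewer than $\omega^n$ steps. $A$ is in $\mathrm{NP}$ if there are a program $p$ and $n\in\omega$ such that $p$ halts on every input pair $(x,y)$ in fewer than $\omega^n$ steps and $x\in A$ iff there exists $y\in\mathbb{R}$ such that $p$ accepts $(x,y)$. $\mathrm{co}\text{-}\mathrm{NP}$ is the class of complements $\mathbb{R}\setminus A$ of sets $A\in\mathrm{NP}$. *)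

theory Defs
  imports Main
begin

text \<open>An ordinal below omega^omega is represented in Cantor normal form
  omega^k * f k + ... + omega * f 1 + f 0 by its finitely supported
  coefficient function f.\<close>

type_synonym ordw = "nat \<Rightarrow> nat"

definition isord :: "ordw \<Rightarrow> bool" where
  "isord f \<longleftrightarrow> finite {i. f i \<noteq> 0}"

definition olt :: "ordw \<Rightarrow> ordw \<Rightarrow> bool" where
  "olt f g \<longleftrightarrow> (\<exists>i. f i < g i \<and> (\<forall>j>i. f j = g j))"

definition ozero :: ordw where
  "ozero = (\<lambda>_. 0)"

definition osuc :: "ordw \<Rightarrow> ordw" where
  "osuc f = f(0 := Suc (f 0))"

definition olimit :: "ordw \<Rightarrow> bool" where
  "olimit f \<longleftrightarrow> isord f \<and> f 0 = 0 \<and> f \<noteq> ozero"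

definition omega_pow :: "nat \<Rightarrow> ordw" where
  "omega_pow n = (\<lambda>i. if i = n then 1 else 0)"

type_synonym real2 = "nat \<Rightarrow> bool"

text \<open>A program: a number N of states (states are 0..<N; 0 = start,
  1 = limit, 2 = halt) and a transition function which, given the state and
  the three bits read (input, scratch, output tape), returns the new state,
  the three bits to write and the head move (True = right, False = left).\<close>
type_synonym program =
  "nat \<times> (nat \<Rightarrow> bool \<Rightarrow> bool \<Rightarrow> bool \<Rightarrow> nat \<times> bool \<times> bool \<times> bool \<times> bool)"

definition q_start :: nat where "q_start = 0"
definition q_limit :: nat where "q_limit = 1"
definition q_halt :: nat where "q_halt = 2"

definition wf_program :: "program \<Rightarrow> bool" where
  "wf_program p \<longleftrightarrow> 3 \<le> fst p \<and>
     (\<forall>q a b c. q < fst p \<longrightarrow> fst (snd p q a b c) < fst p)"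

text \<open>Configuration: state, head position, input tape, scratch tape, output tape.\<close>
type_synonym config = "nat \<times> nat \<times> real2 \<times> real2 \<times> real2"

definition cstate :: "config \<Rightarrow> nat" where "cstate c = fst c"
definition chead :: "config \<Rightarrow> nat" where "chead c = fst (snd c)"
definition ctape1 :: "config \<Rightarrow> real2" where "ctape1 c = fst (snd (snd c))"
definition ctape2 :: "config \<Rightarrow> real2" where "ctape2 c = fst (snd (snd (snd c)))"
definition ctape3 :: "config \<Rightarrow> real2" where "ctape3 c = snd (snd (snd (snd c)))"

definition step :: "program \<Rightarrow> config \<Rightarrow> config" where
  "step p c =
    (let h = chead c;
         (q', w1, w2, w3, mv) = snd p (cstate c) (ctape1 c h) (ctape2 c h) (ctape3 c h)
     in (q', (if mv then Suc h else h - 1),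
         (ctape1 c)(h := w1), (ctape2 c)(h := w2), (ctape3 c)(h := w3)))"

definition initial :: "real2 \<Rightarrow> config" where
  "initial x = (q_start, 0, x, (\<lambda>_. False), (\<lambda>_. False))"

definition olimsup :: "(ordw \<Rightarrow> bool) \<Rightarrow> ordw \<Rightarrow> bool" where
  "olimsup v lam \<longleftrightarrow>
     (\<forall>\<beta>. isord \<beta> \<and> olt \<beta> lam \<longrightarrow>
        (\<exists>\<gamma>. isord \<gamma> \<and> \<not> olt \<gamma> \<beta> \<and> olt \<gamma> lam \<and> v \<gamma>))"

definition limit_config :: "(ordw \<Rightarrow> config) \<Rightarrow> ordw \<Rightarrow> config" where
  "limit_config r lam =
     (q_limit, 0,
      (\<lambda>i. olimsup (\<lambda>\<gamma>. ctape1 (r \<gamma>) i) lam),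
      (\<lambda>i. olimsup (\<lambda>\<gamma>. ctape2 (r \<gamma>) i) lam),
      (\<lambda>i. olimsup (\<lambda>\<gamma>. ctape3 (r \<gamma>) i) lam))"

definition is_run :: "program \<Rightarrow> real2 \<Rightarrow> (ordw \<Rightarrow> config) \<Rightarrow> ordw \<Rightarrow> bool" where
  "is_run p x r \<alpha> \<longleftrightarrow>
     (\<forall>\<beta>. isord \<beta> \<and> (olt \<beta> \<alpha> \<or> \<beta> = \<alpha>) \<longrightarrow>
        (\<beta> = ozero \<longrightarrow> r \<beta> = initial x) \<and>
        (\<forall>\<gamma>. isord \<gamma> \<and> \<beta> = osuc \<gamma> \<longrightarrow> r \<beta> = step p (r \<gamma>)) \<and>
        (olimit \<beta> \<longrightarrow> r \<beta> = limit_config r \<beta>) \<and>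
        (olt \<beta> \<alpha> \<longrightarrow> cstate (r \<beta>) \<noteq> q_halt))"

definition halts_at :: "program \<Rightarrow> real2 \<Rightarrow> ordw \<Rightarrow> config \<Rightarrow> bool" where
  "halts_at p x \<alpha> c \<longleftrightarrow> isord \<alpha> \<and>
     (\<exists>r. is_run p x r \<alpha> \<and> r \<alpha> = c \<and> cstate c = q_halt)"

definition halts_before :: "program \<Rightarrow> real2 \<Rightarrow> ordw \<Rightarrow> bool" where
  "halts_before p x \<delta> \<longleftrightarrow> (\<exists>\<alpha> c. halts_at p x \<alpha> c \<and> olt \<alpha> \<delta>)"

text \<open>Output conventions: the real 1 = 100... means yes, 0 = 000... means no.\<close>
definition yes_real :: real2 where "yes_real = (\<lambda>i. i = 0)"
definition no_real :: real2 where "no_real = (\<lambda>_. False)"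

definition accepts :: "program \<Rightarrow> real2 \<Rightarrow> bool" where
  "accepts p x \<longleftrightarrow> (\<exists>\<alpha> c. halts_at p x \<alpha> c \<and> ctape3 c = yes_real)"

definition rejects :: "program \<Rightarrow> real2 \<Rightarrow> bool" where
  "rejects p x \<longleftrightarrow> (\<exists>\<alpha> c. halts_at p x \<alpha> c \<and> ctape3 c = no_real)"

definition decides :: "program \<Rightarrow> real2 set \<Rightarrow> bool" where
  "decides p A \<longleftrightarrow> (\<forall>x. (x \<in> A \<longrightarrow> accepts p x) \<and> (x \<notin> A \<longrightarrow> rejects p x))"

definition pair_real :: "real2 \<Rightarrow> real2 \<Rightarrow> real2" where
  "pair_real x y = (\<lambda>i. if even i then x (i div 2) else y (i div 2))"

definition class_P :: "real2 set set" where
  "class_P = {A. \<exists>p n. wf_program p \<and> decides p A \<and>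
                 (\<forall>x. halts_before p x (omega_pow n))}"

definition class_NP :: "real2 set set" where
  "class_NP = {A. \<exists>p n. wf_program p \<and>
                 (\<forall>x y. halts_before p (pair_real x y) (omega_pow n)) \<and>
                 (\<forall>x. x \<in> A \<longleftrightarrow> (\<exists>y. accepts p (pair_real x y)))}"

definition class_coNP :: "real2 set set" where
  "class_coNP = {UNIV - A | A. A \<in> class_NP}"

end

theory Submission
  imports Defs "HOL-Library.Nat_Bijection" "HOL-Library.Countable" "HOL-Library.Infinite_Set"
begin

text \<open>
  Read a real x as a circuit of NOR gates with gates numbered by natural numbers. The wire from gate m to gate n
  is present if the corresponding bit of x is set and m precedes n in a fixed recursive well-order
  of type omega to the omega, with a largest element added as root. The separating set A consists of the x whose root
  evaluates to true.

  The values of the gates are determined by x. A guessed assignment of values is correct iff a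
  Pi-0-2 condition holds, and a machine checks this in omega + 1 steps: it searches for the
  certificates of correctness of one gate after the other and raises a flag on the output tape with each
  success, so that at time omega the output is 1 iff there were infinitely many successes. As the
  verdict on the root may be guessed either way, A and its complement are in NP.

  Conversely, let a machine decide A. Its run on any input is described by a circuit with a few levels of gates
  for each stage of the run, and the order is long enough to accommodate it. The circuit can be chosen such
  that it reads its own description as input and its root is true iff the machine does not accept: then the
  machine is wrong on this input.
\<close>

section \<open>Ordinals below omega to the omega\<close>

text \<open>Two numerical choices fit together. A compiled machine keeps its counters in blocks of
  ten cells, and a counter with value c gives access to block c of the input tape as well. Pairing
  puts x on the even and y on the odd positions, so wire bits sit at multiples of 5 in x and guesses
  at multiples of 5 in y.

  The obstacle in the lower bound is self-reference: the circuit has to be the very input whose run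
  it computes. A gate inspecting input bit j has a number n that is at least j, and the wires into
  such a gate are described at positions beyond n, so x can be defined by recursion on positions.

  The order suffices because omega^2 times an ordinal below omega^omega is again below omega^omega:
  stage \<alpha> owns the gates from omega^2 * \<alpha> on. Since a gate may have infinitely many
  inputs, a limit stage can look at all earlier stages at once. On the other side the verifier only
  needs that the comparison of gates is computable.\<close>

lemma olt_irrefl: "\<not> olt f f"
  by (auto simp: olt_def)

lemma olt_trans:
  assumes "olt f g" "olt g h"
  shows "olt f h"
proof -
  obtain i j where i: "f i < g i" "\<forall>k>i. f k = g k" and j: "g j < h j" "\<forall>k>j. g k = h k"
    using assms by (auto simp: olt_def)
  consider "i < j" | "i = j" | "j < i" by linarith
  then show ?thesis
  proof cases
    case 1
    then show ?thesis using i j unfolding olt_def by (intro exI[of _ j]) auto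
  next
    case 2
    then show ?thesis using i j unfolding olt_def by (intro exI[of _ j]) auto
  next
    case 3
    then show ?thesis using i j unfolding olt_def by (intro exI[of _ i]) auto
  qed
qed

lemma olt_linear:
  assumes "isord f" "isord g" "f \<noteq> g"
  shows "olt f g \<or> olt g f"
proof -
  let ?D = "{i. f i \<noteq> g i}"
  have "?D \<subseteq> {i. f i \<noteq> 0} \<union> {i. g i \<noteq> 0}" by auto
  then have fin: "finite ?D"
    using assms by (auto simp: isord_def intro: finite_subset)
  moreover have "?D \<noteq> {}" using assms(3) by auto
  ultimately have "Max ?D \<in> ?D" by (rule Max_in)
  moreover have "\<forall>j>Max ?D. f j = g j"
    using fin Max_ge by fastforce
  ultimately show ?thesis
    unfolding olt_def by (metis (mono_tags, lifting) linorder_neqE_nat mem_Collect_eq)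
qed

text \<open>The highest coordinate in which members of \<open>Q\<close> can differ decides first:
  the members with least value there lie below all others, and among them one coordinate less is
  left to minimise.\<close>

lemma olt_minimal_agreeing:
  assumes "Q \<noteq> {}" "\<And>f g i. f \<in> Q \<Longrightarrow> g \<in> Q \<Longrightarrow> i \<ge> n \<Longrightarrow> f i = g i"
  shows "\<exists>g\<in>Q. \<forall>h. olt h g \<longrightarrow> h \<notin> Q"
  using assms
proof (induction n arbitrary: Q)
  case 0
  then obtain g where "g \<in> Q" by blast
  moreover have "h = g" if "h \<in> Q" for h using 0(2)[OF that \<open>g \<in> Q\<close>] by auto
  ultimately show ?case using olt_irrefl by blast
next
  case (Suc n)
  obtain f0 where "f0 \<in> Q" using Suc.prems(1) by blast
  then obtain f where f: "f \<in> Q" "\<And>g. g \<in> Q \<Longrightarrow> f n \<le> g n"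
    using ex_has_least_nat[of "\<lambda>f. f \<in> Q" f0 "\<lambda>f. f n"] by blast
  let ?Q = "{g \<in> Q. g n = f n}"
  have "\<exists>g\<in>?Q. \<forall>h. olt h g \<longrightarrow> h \<notin> ?Q"
  proof (rule Suc.IH)
    show "?Q \<noteq> {}" using f by auto
    fix g h i assume "g \<in> ?Q" "h \<in> ?Q" "n \<le> i"
    then show "g i = h i" using Suc.prems(2)[of g h i] by (cases "i = n") auto
  qed
  then obtain g where g: "g \<in> ?Q" "\<And>h. olt h g \<Longrightarrow> h \<notin> ?Q" by blast
  have "h \<notin> Q" if hg: "olt h g" for h
  proof
    assume "h \<in> Q"
    obtain i where i: "h i < g i" "\<forall>k>i. h k = g k" using hg by (auto simp: olt_def)
    have "i < Suc n" using Suc.prems(2)[of h g i] \<open>h \<in> Q\<close> g(1) i(1) by (cases "i < Suc n") auto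
    then have "h n = f n" using i g(1) f(2)[OF \<open>h \<in> Q\<close>] by (cases "i = n") auto
    then show False using g(2)[OF hg] \<open>h \<in> Q\<close> by auto
  qed
  then show ?case using g(1) by blast
qed

text \<open>Going down never creates a nonzero coefficient at or above \<open>n\<close>, so only the
  coordinates below \<open>n\<close> matter. Finite support is essential: clearing the ones of the
  constant sequence 1 one after another, from coordinate 0 upwards, descends forever.\<close>

lemma olt_minimal:
  assumes "f \<in> Q" "isord f"
  shows "\<exists>g\<in>Q. \<forall>h. olt h g \<longrightarrow> h \<notin> Q"
proof -
  obtain n where n: "\<And>i. i \<ge> n \<Longrightarrow> f i = 0"
    using assms(2) unfolding isord_def finite_nat_set_iff_bounded
    by (metis (mono_tags, lifting) leD mem_Collect_eq)
  let ?Q = "{g \<in> Q. \<forall>i\<ge>n. g i = 0}"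
  have "\<exists>g\<in>?Q. \<forall>h. olt h g \<longrightarrow> h \<notin> ?Q"
    using assms n by (intro olt_minimal_agreeing[of _ n]) auto
  then obtain g where g: "g \<in> ?Q" "\<And>h. olt h g \<Longrightarrow> h \<notin> ?Q" by blast
  have "h \<notin> Q" if hg: "olt h g" for h
  proof
    assume "h \<in> Q"
    obtain i where i: "h i < g i" "\<forall>k>i. h k = g k" using hg by (auto simp: olt_def)
    then have "i < n" using g(1) by (metis (mono_tags, lifting) mem_Collect_eq not_less not_less_zero)
    then have "\<forall>i\<ge>n. h i = 0" using i g(1) by auto
    then show False using g(2)[OF hg] \<open>h \<in> Q\<close> by auto
  qed
  then show ?thesis using g(1) by blast
qed

lemma olt_induct [consumes 1, case_names less]:
  assumes "isord f" "\<And>f. isord f \<Longrightarrow> (\<And>g. isord g \<Longrightarrow> olt g f \<Longrightarrow> P g) \<Longrightarrow> P f"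
  shows "P f"
proof (rule ccontr)
  assume "\<not> P f"
  then obtain g where "isord g" "\<not> P g" "\<forall>h. olt h g \<longrightarrow> \<not> (isord h \<and> \<not> P h)"
    using olt_minimal[of f "{f. isord f \<and> \<not> P f}"] assms(1) by auto
  then show False using assms(2) by blast
qed

lemma isord_ozero [simp]: "isord ozero"
  by (simp add: isord_def ozero_def)

lemma isord_upd [simp]: "isord (f(i := a)) = isord f"
proof -
  have "{j. (f(i := a)) j \<noteq> 0} \<subseteq> insert i {j. f j \<noteq> 0}"
    "{j. f j \<noteq> 0} \<subseteq> insert i {j. (f(i := a)) j \<noteq> 0}" by auto
  then show ?thesis unfolding isord_def by (meson finite_insert finite_subset)
qed

lemma isord_osuc [simp]: "isord (osuc f) = isord f"
  by (simp add: osuc_def)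

lemma osuc_0 [simp]: "osuc f 0 = Suc (f 0)"
  by (simp add: osuc_def)

lemma osuc_eq_iff [simp]: "osuc f = osuc g \<longleftrightarrow> f = g"
  by (auto simp: osuc_def fun_eq_iff split: if_splits)

lemma osuc_pred: "f 0 \<noteq> 0 \<Longrightarrow> osuc (f(0 := f 0 - 1)) = f"
  by (auto simp: osuc_def)

lemma osuc_neq_ozero [simp]: "osuc f \<noteq> ozero"
  by (auto simp: osuc_def ozero_def fun_eq_iff)

lemma ozero_app: "ozero i = 0"
  by (simp add: ozero_def)

lemma ozero_0 [simp]: "ozero 0 = 0"
  by (simp add: ozero_def)

lemma olt_osuc: "olt f (osuc f)"
  unfolding olt_def osuc_def by (intro exI[of _ 0]) auto

lemma olt_osuc_iff: "olt f (osuc g) \<longleftrightarrow> olt f g \<or> f = g"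
proof
  assume "olt f (osuc g)"
  then obtain i where i: "f i < osuc g i" "\<forall>k>i. f k = osuc g k" by (auto simp: olt_def)
  show "olt f g \<or> f = g"
  proof (cases "i = 0 \<and> f 0 = g 0")
    case True
    then have "f k = g k" for k using i by (cases k) (auto simp: osuc_def)
    then show ?thesis by auto
  next
    case False
    then have "f i < g i" "\<forall>k>i. f k = g k" using i by (auto simp: osuc_def split: if_splits)
    then show ?thesis by (auto simp: olt_def)
  qed
next
  assume "olt f g \<or> f = g"
  then show "olt f (osuc g)" using olt_osuc olt_trans by blast
qed

lemma olt_osuc_osuc [simp]: "olt (osuc f) (osuc g) = olt f g"
  unfolding olt_def osuc_def by (intro ex_cong1) auto

lemma olt_osuc_limit: "g 0 = 0 \<Longrightarrow> olt (osuc f) g = olt f g"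
  unfolding olt_def osuc_def by (intro ex_cong1) auto

lemma not_olt_ozero [simp]: "\<not> olt f ozero"
  by (auto simp: olt_def ozero_app)

lemma ordw_cases:
  assumes "isord f"
  obtains "f = ozero" | g where "f = osuc g" "isord g" | "olimit f"
  using assms osuc_pred[of f] by (metis isord_osuc olimit_def)

text \<open>The product omega * f, which raises each exponent by one. Its values are 0 and the
  limits, so together with \<open>osuc\<close> it generates all ordinals below omega^omega from
  0.\<close>

definition oshift :: "ordw \<Rightarrow> ordw" where
  "oshift f = (\<lambda>i. case i of 0 \<Rightarrow> 0 | Suc i \<Rightarrow> f i)"

lemma oshift_simps [simp]: "oshift f 0 = 0" "oshift f (Suc i) = f i"
  by (simp_all add: oshift_def)

lemma oshift_eq_iff [simp]: "oshift f = oshift g \<longleftrightarrow> f = g"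
  by (metis ext oshift_simps(2))

lemma oshift_ozero [simp]: "oshift ozero = ozero"
  by (auto simp: oshift_def ozero_def fun_eq_iff split: nat.splits)

lemma oshift_eq_ozero [simp]: "oshift f = ozero \<longleftrightarrow> f = ozero"
  by (metis oshift_eq_iff oshift_ozero)

lemma olt_oshift [simp]: "olt (oshift f) (oshift g) = olt f g"
proof
  assume "olt (oshift f) (oshift g)"
  then obtain i where i: "oshift f i < oshift g i" "\<forall>j>i. oshift f j = oshift g j"
    by (auto simp: olt_def)
  then obtain k where "i = Suc k" by (cases i) auto
  then show "olt f g" using i unfolding olt_def
    by (intro exI[of _ k]) (metis Suc_less_eq oshift_simps(2))
next
  assume "olt f g"
  then obtain i where i: "f i < g i" "\<forall>j>i. f j = g j" by (auto simp: olt_def)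
  then show "olt (oshift f) (oshift g)" unfolding olt_def
    by (intro exI[of _ "Suc i"]) (auto simp: oshift_def split: nat.splits)
qed

lemma isord_oshift [simp]: "isord (oshift f) = isord f"
proof -
  have "{i. oshift f i \<noteq> 0} = Suc ` {i. f i \<noteq> 0}"
    by (auto simp: oshift_def image_iff gr0_conv_Suc split: nat.splits)
  then show ?thesis by (simp add: isord_def finite_image_iff)
qed

text \<open>In binary, the runs of ones separated by zeros list the coefficients of the Cantor normal
  form in unary, the least significant run being the finite part.\<close>

fun ord_of :: "nat \<Rightarrow> ordw" where
  "ord_of n = (if n = 0 then ozero
     else if even n then oshift (ord_of (n div 2)) else osuc (ord_of (n div 2)))"

declare ord_of.simps [simp del]

lemma ord_of_0 [simp]: "ord_of 0 = ozero"
  by (simp add: ord_of.simps)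

lemma ord_of_even: "even n \<Longrightarrow> ord_of n = oshift (ord_of (n div 2))"
  by (cases "n = 0") (auto simp: ord_of.simps[of n])

lemma ord_of_odd: "odd n \<Longrightarrow> ord_of n = osuc (ord_of (n div 2))"
  by (auto simp add: ord_of.simps[of n])

lemma isord_ord_of [simp]: "isord (ord_of n)"
proof (induction n rule: ord_of.induct)
  case (1 n)
  then show ?case by (cases "n = 0"; cases "even n") (simp_all add: ord_of_even[of n] ord_of_odd[of n])
qed

text \<open>The finite part tells a value of \<open>oshift\<close> from a successor, so the ordinal
  determines the last bit of its notation. The ordinal 0 is fixed by \<open>oshift\<close>, but the
  number 0 is fixed by doubling as well.\<close>

lemma ord_of_eq_iff [simp]: "ord_of m = ord_of n \<longleftrightarrow> m = n"
proof (induction m arbitrary: n rule: less_induct)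
  case (less m)
  show ?case
  proof (cases "m = 0")
    case True
    have "ord_of n = ozero \<Longrightarrow> n = 0"
    proof (induction n rule: less_induct)
      case (less n)
      show ?case
      proof (rule ccontr)
        assume "n \<noteq> 0"
        then have "ord_of (n div 2) = ozero" "even n"
          using less.prems by (auto simp: ord_of.simps[of n] split: if_splits)
        then have "n div 2 = 0" using less.IH[of "n div 2"] \<open>n \<noteq> 0\<close> by simp
        then show False using \<open>n \<noteq> 0\<close> \<open>even n\<close> by (auto elim!: evenE)
      qed
    qed
    with True show ?thesis by auto
  next
    case False
    then have IH: "ord_of (m div 2) = ord_of (n div 2) \<longleftrightarrow> m div 2 = n div 2"
      using less[of "m div 2" "n div 2"] by simp
    have "oshift f \<noteq> osuc g" "osuc g \<noteq> oshift f" for f g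
      by (metis nat.simps(3) oshift_simps(1) osuc_0)+
    with IH show ?thesis
      by (cases "even m"; cases "even n")
         (auto simp: ord_of_even[of m] ord_of_even[of n] ord_of_odd[of m] ord_of_odd[of n] elim!: evenE oddE, presburger+)
  qed
qed

lemma ord_of_eq_ozero [simp]: "ord_of n = ozero \<longleftrightarrow> n = 0"
  by (metis ord_of_0 ord_of_eq_iff)

lemma ord_of_surj:
  assumes "isord f"
  shows "\<exists>n. ord_of n = f"
proof -
  have "\<exists>n. ord_of n = f" if "\<forall>i\<ge>k. f i = 0" for k f
    using that
  proof (induction k arbitrary: f)
    case 0
    then have "f = ozero" by (auto simp: ozero_def)
    then show ?case by (auto intro: exI[of _ 0])
  next
    case (Suc k)
    show ?case using Suc.prems
    proof (induction "f 0" arbitrary: f)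
      case 0
      then obtain n where "ord_of n = (\<lambda>i. f (Suc i))" using Suc.IH[of "\<lambda>i. f (Suc i)"] by auto
      then have "ord_of (2 * n) = f"
        using 0 by (auto simp: ord_of_even[of "2 * n"] oshift_def fun_eq_iff split: nat.splits)
      then show ?case ..
    next
      case (Suc a)
      then obtain n where n: "ord_of n = f(0 := f 0 - 1)"
        using Suc(1)[of "f(0 := f 0 - 1)"] Suc(2,3) by fastforce
      then have "ord_of (2 * n + 1) = f" using osuc_pred[of f] Suc(2) by (simp add: ord_of_odd)
      then show ?case ..
    qed
  qed
  moreover obtain k where "\<forall>i\<ge>k. f i = 0"
    using assms unfolding isord_def finite_nat_set_iff_bounded
    by (metis (mono_tags, lifting) leD mem_Collect_eq)
  ultimately show ?thesis by blast
qed

text \<open>Bounds the finite part of a gate by the number of the gate. This is what later makes an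
  inspected input bit precede the bits that describe the wires of the gate.\<close>

lemma ord_of_finite_part_le: "ord_of n 0 \<le> n"
proof (induction n rule: less_induct)
  case (less n)
  show ?case
  proof (cases "even n")
    case True
    then show ?thesis by (simp add: ord_of_even[of n])
  next
    case False
    then have "n div 2 < n" by (auto elim!: oddE)
    then show ?thesis using less[of "n div 2"] False by (auto simp: ord_of_odd[of n])
  qed
qed

text \<open>Reads both numbers from the least significant bit; r holds the verdict for the case
  that the parts not yet read agree.\<close>

function cmp :: "bool \<Rightarrow> nat \<Rightarrow> nat \<Rightarrow> bool" where
  "cmp r m n = (if m = 0 \<and> n = 0 then r
     else if odd m \<and> odd n then cmp r (m div 2) (n div 2)
     else if odd m then cmp False (m div 2) n
     else if odd n then cmp True m (n div 2)
     else cmp r (m div 2) (n div 2))"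
  by auto
termination
  by (relation "measure (\<lambda>(r, m, n). m + n)") (auto elim!: oddE evenE)

declare cmp.simps [simp del]

lemma cmp_eq: "cmp r m n = (if m = n then r else olt (ord_of m) (ord_of n))"
proof (induction r m n rule: cmp.induct)
  case (1 r m n)
  consider "m = 0 \<and> n = 0" | "odd m" "odd n" | "odd m" "even n" | "even m" "odd n"
    | "\<not> (m = 0 \<and> n = 0)" "even m" "even n" by blast
  then show ?case
  proof cases
    case 1
    then show ?thesis by (simp add: cmp.simps)
  next
    case 2
    then have "m = n \<longleftrightarrow> m div 2 = n div 2" by (auto elim!: oddE)
    with 2 1 show ?thesis by (auto simp: cmp.simps[of r m n] ord_of_odd[of m] ord_of_odd[of n])
  next
    case 3
    then have "ord_of n 0 = 0" by (simp add: ord_of_even[of n])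
    then have "olt (ord_of m) (ord_of n) = olt (ord_of (m div 2)) (ord_of n)"
      using 3 by (simp add: ord_of_odd[of m] olt_osuc_limit)
    moreover have "cmp r m n = cmp False (m div 2) n"
      using 3 by (auto simp: cmp.simps[of r m n])
    moreover have "cmp False (m div 2) n = (if m div 2 = n then False else olt (ord_of (m div 2)) (ord_of n))"
      using 3 by (intro 1(2)) (auto elim: oddE)
    ultimately show ?thesis using 3 by (auto simp: olt_irrefl)
  next
    case 4
    then have "cmp r m n = cmp True m (n div 2)"
      by (auto simp: cmp.simps[of r m n])
    moreover have "cmp True m (n div 2) = (if m = n div 2 then True else olt (ord_of m) (ord_of (n div 2)))"
      using 4 by (intro 1(3)) (auto elim: oddE)
    moreover have "olt (ord_of m) (ord_of n) = (olt (ord_of m) (ord_of (n div 2)) \<or> m = n div 2)"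
      using 4 by (simp add: ord_of_odd[of n] olt_osuc_iff)
    ultimately show ?thesis using 4 by auto
  next
    case 5
    then have "m = n \<longleftrightarrow> m div 2 = n div 2" by (auto elim!: evenE)
    with 5 1 show ?thesis by (auto simp: cmp.simps[of r m n] ord_of_even[of m] ord_of_even[of n])
  qed
qed

section \<open>Runs\<close>

lemma is_run_unique:
  assumes r: "is_run p x r a" and r': "is_run p x r' a'" and "isord b"
    and "olt b a \<or> b = a" "olt b a' \<or> b = a'"
  shows "r b = r' b"
  using assms(3-)
proof (induction b rule: olt_induct)
  case (less b)
  have below: "r c = r' c" if "isord c" "olt c b" for c
    using less that olt_trans by blast
  show ?case
  proof (cases rule: ordw_cases[OF \<open>isord b\<close>])
    case 1
    then show ?thesis using r r' less unfolding is_run_def by metis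
  next
    case (2 c)
    then have "r c = r' c" using below olt_osuc by blast
    moreover have "r b = step p (r c)" "r' b = step p (r' c)"
      using r r' less 2 unfolding is_run_def by blast+
    ultimately show ?thesis by simp
  next
    case 3
    then have "r b = limit_config r b" "r' b = limit_config r' b"
      using r r' less unfolding is_run_def by blast+
    moreover have "limit_config r b = limit_config r' b"
      using below unfolding limit_config_def olimsup_def by (simp cong: conj_cong)
    ultimately show ?thesis by simp
  qed
qed

lemma is_run_not_halted: "is_run p x r a \<Longrightarrow> isord b \<Longrightarrow> olt b a \<Longrightarrow> cstate (r b) \<noteq> q_halt"
  unfolding is_run_def by blast

text \<open>\<open>accepts\<close> asserts that some halting run has the right output. Uniqueness
  allows non-acceptance to be read off from a single run.\<close>

lemma halts_at_unique:
  assumes "halts_at p x a c" "halts_at p x a' c'"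
  shows "a = a' \<and> c = c'"
proof -
  obtain r r' where r: "is_run p x r a" "r a = c" "cstate c = q_halt" "isord a"
    and r': "is_run p x r' a'" "r' a' = c'" "cstate c' = q_halt" "isord a'"
    using assms by (auto simp: halts_at_def)
  have "\<not> olt a a'"
  proof
    assume "olt a a'"
    then have "r a = r' a" "cstate (r' a) \<noteq> q_halt"
      using is_run_unique[OF r(1) r'(1)] is_run_not_halted[OF r'(1)] r(4) by blast+
    then show False using r by simp
  qed
  moreover have "\<not> olt a' a"
  proof
    assume "olt a' a"
    then have "r a' = r' a'" "cstate (r a') \<noteq> q_halt"
      using is_run_unique[OF r(1) r'(1)] is_run_not_halted[OF r(1)] r'(4) by blast+
    then show False using r' by simp
  qed
  ultimately have "a = a'" using olt_linear r(4) r'(4) by blast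
  then show ?thesis using is_run_unique[OF r(1) r'(1) r(4)] r(2) r'(2) by blast
qed

section \<open>Runs that halt at a finite stage or right after omega\<close>

definition fin_ord :: "nat \<Rightarrow> ordw" where
  "fin_ord n = ozero(0 := n)"

lemma fin_ord_simps [simp]: "isord (fin_ord n)" "fin_ord n 0 = n" "fin_ord n = fin_ord m \<longleftrightarrow> n = m"
  by (auto simp: fin_ord_def fun_eq_iff)

lemma fin_ord_0: "fin_ord 0 = ozero"
  by (auto simp: fin_ord_def ozero_def fun_eq_iff)

lemma osuc_fin_ord: "osuc (fin_ord n) = fin_ord (Suc n)"
  by (auto simp: fin_ord_def osuc_def)

lemma olt_fin_ord [simp]: "olt (fin_ord m) (fin_ord n) \<longleftrightarrow> m < n"
  by (auto simp: olt_def fin_ord_def ozero_app intro: exI[of _ 0] split: if_splits)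

lemma olt_fin_ord_iff: "olt f (fin_ord n) \<longleftrightarrow> (\<exists>m<n. f = fin_ord m)"
proof
  assume "olt f (fin_ord n)"
  then obtain i where i: "f i < fin_ord n i" "\<forall>j>i. f j = fin_ord n j" by (auto simp: olt_def)
  then have "i = 0" by (auto simp: fin_ord_def ozero_app split: if_splits)
  with i have "f = fin_ord (f 0)" "f 0 < n" by (auto simp: fin_ord_def fun_eq_iff)
  then show "\<exists>m<n. f = fin_ord m" by blast
qed auto

lemma olt_omega_iff: "olt f (omega_pow 1) \<longleftrightarrow> (\<exists>n. f = fin_ord n)"
proof
  assume "olt f (omega_pow 1)"
  then obtain i where i: "f i < omega_pow 1 i" "\<forall>j>i. f j = omega_pow 1 j" by (auto simp: olt_def)
  then have "i = 1" by (auto simp: omega_pow_def split: if_splits)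
  have "f j = fin_ord (f 0) j" for j
    using i \<open>i = 1\<close>
    by (cases j; cases "j = 1") (auto simp: omega_pow_def fin_ord_def ozero_def split: if_splits)
  then show "\<exists>n. f = fin_ord n" by blast
next
  assume "\<exists>n. f = fin_ord n"
  then show "olt f (omega_pow 1)"
    unfolding olt_def by (auto simp: omega_pow_def fin_ord_def ozero_app intro!: exI[of _ 1])
qed

lemma isord_omega_pow [simp]: "isord (omega_pow n)"
  by (simp add: isord_def omega_pow_def)

lemma omega_pow_0 [simp]: "omega_pow (Suc n) 0 = 0"
  by (simp add: omega_pow_def)

lemma fin_ord_neq_omega [simp]: "fin_ord n \<noteq> omega_pow (Suc k)"
  by (auto simp: fin_ord_def omega_pow_def ozero_app fun_eq_iff intro!: exI[of _ "Suc k"])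

lemma olimsup_omega: "olimsup v (omega_pow 1) \<longleftrightarrow> (\<exists>\<^sub>\<infinity>n. v (fin_ord n))"
  unfolding olimsup_def olt_omega_iff INFM_nat_le
  by (metis fin_ord_simps(1) leI not_le olt_fin_ord)

definition limit_of_orbit :: "program \<Rightarrow> config \<Rightarrow> config" where
  "limit_of_orbit p c =
    (q_limit, 0,
     (\<lambda>i. \<exists>\<^sub>\<infinity>n. ctape1 ((step p ^^ n) c) i),
     (\<lambda>i. \<exists>\<^sub>\<infinity>n. ctape2 ((step p ^^ n) c) i),
     (\<lambda>i. \<exists>\<^sub>\<infinity>n. ctape3 ((step p ^^ n) c) i))"

lemma halts_at_finite:
  assumes "cstate ((step p ^^ n) (initial z)) = q_halt"
    and "\<And>i. i < n \<Longrightarrow> cstate ((step p ^^ i) (initial z)) \<noteq> q_halt"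
  shows "halts_at p z (fin_ord n) ((step p ^^ n) (initial z))"
proof -
  \<comment> \<open>A run has to be correct only up to its last stage. All stages in question are
    finite and equal their coefficient \<open>b 0\<close>; the values elsewhere are
    arbitrary.\<close>
  let ?r = "\<lambda>b :: ordw. (step p ^^ (b 0)) (initial z)"
  have "is_run p z ?r (fin_ord n)"
    unfolding is_run_def
  proof (intro allI impI)
    fix b assume b: "isord b \<and> (olt b (fin_ord n) \<or> b = fin_ord n)"
    then obtain m where m: "b = fin_ord m" "m \<le> n" by (auto simp: olt_fin_ord_iff)
    have "\<not> olimit b" using m by (auto simp: olimit_def fin_ord_0)
    then show "(b = ozero \<longrightarrow> ?r b = initial z) \<and>
        (\<forall>c. isord c \<and> b = osuc c \<longrightarrow> ?r b = step p (?r c)) \<and>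
        (olimit b \<longrightarrow> ?r b = limit_config ?r b) \<and>
        (olt b (fin_ord n) \<longrightarrow> cstate (?r b) \<noteq> q_halt)"
      using assms(2) m by auto
  qed
  then show ?thesis using assms(1) unfolding halts_at_def by (auto intro!: exI[of _ ?r])
qed

lemma halts_at_omega:
  assumes "\<And>i. cstate ((step p ^^ i) (initial z)) \<noteq> q_halt"
    and "cstate (step p (limit_of_orbit p (initial z))) = q_halt"
  shows "halts_at p z (osuc (omega_pow 1)) (step p (limit_of_orbit p (initial z)))"
proof -
  let ?w = "omega_pow 1" and ?l = "limit_of_orbit p (initial z)"
  define r :: "ordw \<Rightarrow> config" where "r = (\<lambda>b. if b = ?w then ?l else if b = osuc ?w then step p ?l
     else (step p ^^ (b 0)) (initial z))"
  have r_fin: "r (fin_ord n) = (step p ^^ n) (initial z)" for n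
  proof -
    have "fin_ord n \<noteq> osuc ?w"
      by (auto simp: fin_ord_def omega_pow_def osuc_def ozero_app fun_eq_iff intro!: exI[of _ 1])
    then show ?thesis using fin_ord_neq_omega[of n 0] by (simp add: r_def)
  qed
  have r_w: "r ?w = ?l" by (simp add: r_def)
  have neq: "osuc ?w \<noteq> ?w" using olt_osuc[of ?w] olt_irrefl[of ?w] by metis
  have "is_run p z r (osuc ?w)"
    unfolding is_run_def
  proof (intro allI impI)
    fix b assume b: "isord b \<and> (olt b (osuc ?w) \<or> b = osuc ?w)"
    then consider m where "b = fin_ord m" | "b = ?w" | "b = osuc ?w"
      using olt_osuc_iff olt_omega_iff by blast
    then show "(b = ozero \<longrightarrow> r b = initial z) \<and>
        (\<forall>c. isord c \<and> b = osuc c \<longrightarrow> r b = step p (r c)) \<and>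
        (olimit b \<longrightarrow> r b = limit_config r b) \<and>
        (olt b (osuc ?w) \<longrightarrow> cstate (r b) \<noteq> q_halt)"
    proof cases
      case (1 m)
      have "\<not> olimit b" using 1 by (auto simp: olimit_def fin_ord_0)
      moreover have "r b = step p (r c)" if bc: "b = osuc c" for c
      proof -
        have "b 0 \<noteq> 0" using bc by simp
        then obtain k where "m = Suc k" using 1 by (cases m) auto
        then have "c = fin_ord k" using bc 1 by (simp flip: osuc_fin_ord)
        then show ?thesis using 1 \<open>m = Suc k\<close> r_fin by simp
      qed
      moreover have "b = ozero \<longrightarrow> r b = initial z"
        using r_fin[of 0] by (simp add: fin_ord_0)
      ultimately show ?thesis using assms(1) 1 r_fin by simp
    next
      case 2
      have "?w \<noteq> ozero" by (auto simp: omega_pow_def ozero_def fun_eq_iff)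
      moreover have "?w \<noteq> osuc c" for c by (metis One_nat_def nat.simps(3) omega_pow_0 osuc_0)
      moreover have "r b = limit_config r b"
        unfolding 2 r_w limit_config_def olimsup_omega r_fin limit_of_orbit_def ..
      moreover have "cstate (r b) \<noteq> q_halt"
        unfolding 2 r_w by (simp add: limit_of_orbit_def cstate_def q_limit_def q_halt_def)
      ultimately show ?thesis unfolding 2 by blast
    next
      case 3
      have "\<not> olimit b" using 3 by (auto simp: olimit_def)
      moreover have "r b = step p (r ?w)" unfolding r_w using 3 neq by (simp add: r_def)
      ultimately show ?thesis using 3 olt_irrefl[of "osuc ?w"] by (metis osuc_eq_iff osuc_neq_ozero)
    qed
  qed
  moreover have "r (osuc ?w) = step p ?l" using neq by (simp add: r_def)
  ultimately show ?thesis using assms(2) unfolding halts_at_def by auto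
qed

section \<open>Recurrent events of deterministic systems\<close>

text \<open>At stage omega a cell is 1 iff the event that it shows 1 recurs. The notion is kept
  abstract so that it can be carried along simulations, from the machine to the counter program and
  on to the search.\<close>

definition recurs :: "('s \<Rightarrow> 's) \<Rightarrow> ('s \<Rightarrow> bool) \<Rightarrow> 's \<Rightarrow> bool" where
  "recurs f F s \<longleftrightarrow> (\<exists>\<^sub>\<infinity>i. F ((f ^^ i) s))"

lemma recurs_funpow: "recurs f F ((f ^^ t) s) = recurs f F s"
proof
  assume "recurs f F ((f ^^ t) s)"
  then have "\<exists>\<^sub>\<infinity>i. F ((f ^^ (i + t)) s)" by (simp add: recurs_def funpow_add)
  then show "recurs f F s" unfolding recurs_def INFM_nat_le by (meson trans_le_add1)
next
  assume r: "recurs f F s"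
  show "recurs f F ((f ^^ t) s)" unfolding recurs_def INFM_nat_le
  proof
    fix n
    obtain i where "i \<ge> n + t" "F ((f ^^ i) s)" using r unfolding recurs_def INFM_nat_le by blast
    then have "i - t \<ge> n" "F ((f ^^ (i - t)) ((f ^^ t) s))"
      by (simp_all flip: funpow_add[THEN fun_cong, unfolded comp_def])
    then show "\<exists>i\<ge>n. F ((f ^^ i) ((f ^^ t) s))" by blast
  qed
qed

text \<open>Step \<open>n\<close> of the abstract system occupies the times from \<open>T n\<close>
  up to \<open>T (Suc n)\<close>, exclusively. These intervals are nonempty, finite and partition
  the natural numbers, so infinitely many events on one side force infinitely many on the
  other.\<close>

lemma recurs_simulation:
  assumes "sim s a"
    and step: "\<And>s a. sim s a \<Longrightarrow>
      \<exists>t>0. sim ((f ^^ t) s) (g a) \<and> ((\<exists>i<t. F ((f ^^ i) s)) \<longleftrightarrow> G a)"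
  shows "recurs f F s \<longleftrightarrow> recurs g G a"
proof -
  obtain t where t: "\<And>s a. sim s a \<Longrightarrow> t s a > 0 \<and> sim ((f ^^ t s a) s) (g a) \<and>
      ((\<exists>i<t s a. F ((f ^^ i) s)) \<longleftrightarrow> G a)"
    using step by metis
  define T where "T = rec_nat 0 (\<lambda>n u. u + t ((f ^^ u) s) ((g ^^ n) a))"
  have T_Suc: "T (Suc n) = T n + t ((f ^^ T n) s) ((g ^^ n) a)" for n by (simp add: T_def)
  have sim: "sim ((f ^^ T n) s) ((g ^^ n) a)" for n
  proof (induction n)
    case 0
    then show ?case using assms(1) by (simp add: T_def)
  next
    case (Suc n)
    let ?u = "t ((f ^^ T n) s) ((g ^^ n) a)"
    have "(f ^^ T (Suc n)) s = (f ^^ ?u) ((f ^^ T n) s)"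
      by (simp add: T_Suc add.commute[of "T n"] funpow_add)
    then show ?case using t[OF Suc] by simp
  qed
  have "T n < T (Suc n)" for n using t[OF sim[of n]] by (simp add: T_Suc)
  then have mono: "strict_mono T" by (simp add: strict_mono_Suc_iff)
  have G: "G ((g ^^ n) a) \<longleftrightarrow> (\<exists>i. T n \<le> i \<and> i < T (Suc n) \<and> F ((f ^^ i) s))" for n
  proof -
    let ?u = "t ((f ^^ T n) s) ((g ^^ n) a)"
    have "G ((g ^^ n) a) \<longleftrightarrow> (\<exists>i<?u. F ((f ^^ (i + T n)) s))"
      using t[OF sim[of n]] by (simp add: funpow_add)
    also have "\<dots> \<longleftrightarrow> (\<exists>i. T n \<le> i \<and> i < T (Suc n) \<and> F ((f ^^ i) s))"
    proof
      assume "\<exists>i<?u. F ((f ^^ (i + T n)) s)"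
      then obtain i where "i < ?u" "F ((f ^^ (i + T n)) s)" by blast
      then show "\<exists>i. T n \<le> i \<and> i < T (Suc n) \<and> F ((f ^^ i) s)"
        unfolding T_Suc by (intro exI[of _ "i + T n"]) simp
    next
      assume "\<exists>i. T n \<le> i \<and> i < T (Suc n) \<and> F ((f ^^ i) s)"
      then obtain i where "T n \<le> i" "i < T (Suc n)" "F ((f ^^ i) s)" by blast
      then show "\<exists>i<?u. F ((f ^^ (i + T n)) s)"
        unfolding T_Suc by (intro exI[of _ "i - T n"]) auto
    qed
    finally show ?thesis .
  qed
  show ?thesis
  proof
    assume r: "recurs f F s"
    show "recurs g G a" unfolding recurs_def INFM_nat_le
    proof
      fix m
      obtain i where i: "i \<ge> T m" "F ((f ^^ i) s)" using r unfolding recurs_def INFM_nat_le by blast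
      have "i < T (Suc i)" using strict_mono_imp_increasing[OF mono, of "Suc i"] by simp
      then obtain n where n: "i < T (Suc n)" "\<And>k. i < T (Suc k) \<Longrightarrow> n \<le> k"
        using LeastI[of "\<lambda>k. i < T (Suc k)" i] Least_le[of "\<lambda>k. i < T (Suc k)"] by blast
      have "T n \<le> i"
      proof (cases n)
        case 0
        then show ?thesis by (simp add: T_def)
      next
        case (Suc k)
        then show ?thesis using n(2)[of k] by (meson Suc_n_not_le_n not_le)
      qed
      moreover have "m \<le> n"
        using i(1) n(1) strict_mono_less[OF mono, of m "Suc n"] by simp
      ultimately show "\<exists>n\<ge>m. G ((g ^^ n) a)" using i n G by blast
    qed
  next
    assume r: "recurs g G a"
    show "recurs f F s" unfolding recurs_def INFM_nat_le
    proof
      fix m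
      obtain n where "n \<ge> m" "G ((g ^^ n) a)" using r unfolding recurs_def INFM_nat_le by blast
      moreover have "n \<le> T n" using strict_mono_imp_increasing[OF mono] .
      ultimately show "\<exists>i\<ge>m. F ((f ^^ i) s)" using G le_trans by blast
    qed
  qed
qed

text \<open>The event is forbidden at the source only. A chain of quiet steps may thus lead up to an
  event, and joined chains check every state except the last.\<close>

definition quiet_step :: "('s \<Rightarrow> 's) \<Rightarrow> ('s \<Rightarrow> bool) \<Rightarrow> 's \<Rightarrow> 's \<Rightarrow> bool" where
  "quiet_step f F s s' \<longleftrightarrow> s' = f s \<and> \<not> F s"

lemma quiet_steps_funpow:
  assumes "(quiet_step f F)\<^sup>*\<^sup>* s s'"
  shows "\<exists>t. (f ^^ t) s = s' \<and> (\<forall>i<t. \<not> F ((f ^^ i) s))"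
  using assms
proof (induction rule: rtranclp_induct)
  case base
  then show ?case by (auto intro: exI[of _ 0])
next
  case (step s1 s2)
  then obtain t where "(f ^^ t) s = s1" "\<forall>i<t. \<not> F ((f ^^ i) s)" by blast
  then show ?case using step(2) less_Suc_eq
    by (intro exI[of _ "Suc t"]) (auto simp: quiet_step_def)
qed

lemma quiet_steps_funpow_pos:
  assumes "(quiet_step f F)\<^sup>+\<^sup>+ s s'"
  shows "\<exists>t>0. (f ^^ t) s = s' \<and> (\<forall>i<t. \<not> F ((f ^^ i) s))"
proof -
  obtain s1 where s1: "quiet_step f F s s1" "(quiet_step f F)\<^sup>*\<^sup>* s1 s'"
    using tranclpD[OF assms] by blast
  then obtain t where t: "(f ^^ t) s1 = s'" "\<forall>i<t. \<not> F ((f ^^ i) s1)"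
    using quiet_steps_funpow by metis
  have "\<not> F ((f ^^ i) s)" if "i < Suc t" for i
    using that s1(1) t(2) by (cases i) (auto simp: quiet_step_def funpow_swap1)
  then show ?thesis using s1(1) t(1)
    by (intro exI[of _ "Suc t"]) (auto simp: quiet_step_def funpow_swap1)
qed

section \<open>Counter machines with oracle\<close>

text \<open>\<open>In j r\<close> reads the input in column \<open>r\<close> of block
  \<open>c j\<close>, the very place where the scratch tape tells whether \<open>c j < c r\<close>.
  So \<open>Lt\<close> and \<open>In\<close> compile to the same head movement and differ in the
  tape that is consulted. \<open>Flash\<close> is the event that raises the output flag.\<close>

datatype instr = Inc nat nat | Dec nat nat | Lt nat nat nat nat | In nat nat nat nat | Flash nat | Halt

type_synonym cmstate = "nat \<times> (nat \<Rightarrow> nat)"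

fun exec :: "real2 \<Rightarrow> instr \<Rightarrow> cmstate \<Rightarrow> cmstate" where
  "exec z (Inc j l) (pc, c) = (l, c(j := Suc (c j)))"
| "exec z (Dec j l) (pc, c) = (l, c(j := c j - 1))"
| "exec z (Lt j r l1 l0) (pc, c) = (if c j < c r then l1 else l0, c)"
| "exec z (In j r l1 l0) (pc, c) = (if z (10 * c j + r) then l1 else l0, c)"
| "exec z (Flash l) (pc, c) = (l, c)"
| "exec z Halt (pc, c) = (pc, c)"

definition cmstep :: "instr list \<Rightarrow> real2 \<Rightarrow> cmstate \<Rightarrow> cmstate" where
  "cmstep code z s = exec z (code ! fst s) s"

definition at_flash :: "instr list \<Rightarrow> cmstate \<Rightarrow> bool" where
  "at_flash code s \<longleftrightarrow> (\<exists>l. code ! fst s = Flash l)"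

text \<open>Column 0 is reserved for the left end marker, so counters start at 1; an oracle query
  may use column 0, as it looks at the input tape.\<close>

fun ok_instr :: "nat \<Rightarrow> instr \<Rightarrow> bool" where
  "ok_instr L (Inc j l) \<longleftrightarrow> 1 \<le> j \<and> j < 10 \<and> l < L"
| "ok_instr L (Dec j l) \<longleftrightarrow> 1 \<le> j \<and> j < 10 \<and> l < L"
| "ok_instr L (Lt j r l1 l0) \<longleftrightarrow> 1 \<le> j \<and> j < 10 \<and> 1 \<le> r \<and> r < 10 \<and> j \<noteq> r \<and> l1 < L \<and> l0 < L"
| "ok_instr L (In j r l1 l0) \<longleftrightarrow> 1 \<le> j \<and> j < 10 \<and> r < 10 \<and> j \<noteq> r \<and> l1 < L \<and> l0 < L"
| "ok_instr L (Flash l) \<longleftrightarrow> l < L"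
| "ok_instr L Halt \<longleftrightarrow> True"

definition ok_code :: "instr list \<Rightarrow> bool" where
  "ok_code code \<longleftrightarrow> code \<noteq> [] \<and> (\<forall>i\<in>set code. ok_instr (length code) i)"

section \<open>Compilation to infinite time Turing machines\<close>

text \<open>Counter j (between 1 and 9) with value c is stored as ones on the scratch cells 10 i + j
  with i < c. Scratch cell 0 carries the only one at a multiple of 10, so that the head can find the
  left end. The third component of a working state is the head position modulo 10. A left move on
  cell 0 leaves the head there.\<close>

datatype phase = Ex | Loc | Goto | Back | Ret | Fl

datatype tst = Start | Limit | Stop | W phase nat nat

fun reg :: "instr \<Rightarrow> nat" where
  "reg (Inc j l) = j"
| "reg (Dec j l) = j"
| "reg (Lt j r l1 l0) = j"
| "reg (In j r l1 l0) = j"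
| "reg _ = 0"

text \<open>\<open>Loc\<close> walks right to the first zero in the column of the counter, hence
  into block c for value c. \<open>Goto\<close> moves inside that block to column r.
  \<open>Back\<close> serves \<open>Dec\<close>: it walks left to the last one of the column, or to
  the marker if the counter is 0. \<open>Ret\<close> walks left to the marker, and \<open>Fl\<close>
  takes the flag down. The limit state stops at once and so delivers the limsup as output.\<close>

fun delta :: "instr list \<Rightarrow> tst \<Rightarrow> bool \<Rightarrow> bool \<Rightarrow> bool \<Rightarrow> tst \<times> bool \<times> bool \<times> bool \<times> bool" where
  "delta code Start a s e = (W Ex 0 0, a, True, e, False)"
| "delta code Limit a s e = (Stop, a, s, e, False)"
| "delta code Stop a s e = (Stop, a, s, e, False)"
| "delta code (W Ex pc k) a s e = (case code ! pc of
      Flash l \<Rightarrow> (W Fl l 0, a, s, True, False)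
    | Halt \<Rightarrow> (Stop, a, s, e, False)
    | _ \<Rightarrow> (W Loc pc 0, a, s, e, False))"
| "delta code (W Fl pc k) a s e = (W Ex pc 0, a, s, False, False)"
| "delta code (W Loc pc k) a s e =
    (if k = reg (code ! pc) \<and> \<not> s then (case code ! pc of
        Inc j l \<Rightarrow> (W Ret l ((k + 1) mod 10), a, True, e, True)
      | Dec j l \<Rightarrow> (W Back pc (k - 1), a, s, e, False)
      | Lt j r l1 l0 \<Rightarrow> (if k < r then (W Goto pc (k + 1), a, s, e, True)
                        else (W Goto pc (k - 1), a, s, e, False))
      | In j r l1 l0 \<Rightarrow> (if k < r then (W Goto pc (k + 1), a, s, e, True)
                        else (W Goto pc (k - 1), a, s, e, False))
      | _ \<Rightarrow> (Stop, a, s, e, False))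
     else (W Loc pc ((k + 1) mod 10), a, s, e, True))"
| "delta code (W Goto pc k) a s e = (case code ! pc of
      Lt j r l1 l0 \<Rightarrow>
        (if k = r then (W Ret (if s then l1 else l0) ((k + 1) mod 10), a, s, e, True)
         else if k < r then (W Goto pc (k + 1), a, s, e, True)
         else (W Goto pc (k - 1), a, s, e, False))
    | In j r l1 l0 \<Rightarrow>
        (if k = r then (W Ret (if a then l1 else l0) ((k + 1) mod 10), a, s, e, True)
         else if k < r then (W Goto pc (k + 1), a, s, e, True)
         else (W Goto pc (k - 1), a, s, e, False))
    | _ \<Rightarrow> (Stop, a, s, e, False))"
| "delta code (W Back pc k) a s e = (case code ! pc of
      Dec j l \<Rightarrow>
        (if k = 0 \<and> s then (W Ex l 0, a, s, e, False)
         else if k = j then (W Ret l ((k + 1) mod 10), a, False, e, True)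
         else (W Back pc ((k + 9) mod 10), a, s, e, False))
    | _ \<Rightarrow> (Stop, a, s, e, False))"
| "delta code (W Ret l k) a s e =
    (if k = 0 \<and> s then (W Ex l 0, a, s, e, False)
     else (W Ret l ((k + 9) mod 10), a, s, e, False))"

fun phase_num :: "phase \<Rightarrow> nat" where
  "phase_num Ex = 0" | "phase_num Loc = 1" | "phase_num Goto = 2"
| "phase_num Back = 3" | "phase_num Ret = 4" | "phase_num Fl = 5"

fun enc :: "tst \<Rightarrow> nat" where
  "enc Start = 0" | "enc Limit = 1" | "enc Stop = 2"
| "enc (W ph pc k) = 3 + prod_encode (phase_num ph, prod_encode (pc, k))"

lemma phase_num_inject: "phase_num a = phase_num b \<longleftrightarrow> a = b"
  by (cases a; cases b) auto

lemma enc_inject: "enc s = enc t \<longleftrightarrow> s = t"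
  by (cases s; cases t) (auto simp: prod_encode_eq phase_num_inject)

definition tstates :: "nat \<Rightarrow> tst set" where
  "tstates L = {Start, Limit, Stop} \<union> (\<Union>ph. \<Union>pc<L. \<Union>k<10. {W ph pc k})"

lemma tstates_simps [simp]: "Start \<in> tstates L" "Limit \<in> tstates L" "Stop \<in> tstates L"
  "W ph pc k \<in> tstates L \<longleftrightarrow> pc < L \<and> k < 10"
  by (auto simp: tstates_def)

lemma finite_tstates: "finite (tstates L)"
proof -
  have "(UNIV :: phase set) = {Ex, Loc, Goto, Back, Ret, Fl}" using phase.exhaust by blast
  then have "finite (UNIV :: phase set)" by (metis finite.emptyI finite_insert)
  then show ?thesis by (simp add: tstates_def)
qed

text \<open>The codes of states have gaps, so the number of states is one more than the largest
  code. A code in a gap leads to the halting state 2.\<close>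

definition tm :: "instr list \<Rightarrow> program" where
  "tm code = (Suc (Max (enc ` tstates (length code))), \<lambda>q a s e.
     if q \<in> enc ` tstates (length code)
     then (let (st, w) = delta code (the_inv enc q) a s e in (enc st, w))
     else (2, a, s, e, False))"

lemma delta_closed:
  assumes "ok_code code" "st \<in> tstates (length code)"
  shows "fst (delta code st a s e) \<in> tstates (length code)"
proof (cases st)
  case (W ph pc k)
  then have pc: "pc < length code" "k < 10" using assms by auto
  then have ok: "ok_instr (length code) (code ! pc)" using assms(1) by (simp add: ok_code_def)
  show ?thesis
    using pc ok W by (cases ph; cases "code ! pc") auto
qed (use assms in \<open>auto simp: ok_code_def\<close>)

lemma the_inv_enc [simp]: "the_inv enc (enc st) = st"
  by (rule the_inv_f_f) (simp add: inj_def enc_inject)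

lemma wf_tm:
  assumes "ok_code code"
  shows "wf_program (tm code)"
proof -
  let ?S = "enc ` tstates (length code)"
  have fin: "finite ?S" using finite_tstates by blast
  have "enc Stop \<in> ?S" by (rule imageI) simp
  then have two: "2 \<le> Max ?S" using fin Max_ge by fastforce
  have "fst (snd (tm code) q a s e) < Suc (Max ?S)" for q a s e
  proof (cases "q \<in> ?S")
    case True
    then obtain st where st: "q = enc st" "st \<in> tstates (length code)" by blast
    have "enc (fst (delta code st a s e)) \<in> ?S"
      using delta_closed[OF assms st(2)] by (rule imageI)
    moreover have "fst (snd (tm code) q a s e) = enc (fst (delta code st a s e))"
      using True st(1) by (simp add: tm_def split: prod.split)
    ultimately show ?thesis using fin Max_ge by (simp add: le_imp_less_Suc)
  next
    case False
    then show ?thesis using two by (simp add: tm_def)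
  qed
  then show ?thesis using two by (simp add: wf_program_def tm_def)
qed

lemma step_tm:
  assumes "st \<in> tstates (length code)"
  shows "step (tm code) (enc st, h, a, s, e) =
    (case delta code st (a h) (s h) (e h) of (st', w1, w2, w3, mv) \<Rightarrow>
      (enc st', if mv then Suc h else h - 1, a(h := w1), s(h := w2), e(h := w3)))"
  using assms
  by (simp add: step_def tm_def chead_def cstate_def ctape1_def ctape2_def ctape3_def split: prod.split)

section \<open>Counter instructions carried out by the machine\<close>

definition out0 :: "config \<Rightarrow> bool" where
  "out0 c \<longleftrightarrow> ctape3 c 0"

abbreviation blank :: real2 where
  "blank \<equiv> \<lambda>_. False"

definition ctr_tape :: "(nat \<Rightarrow> nat) \<Rightarrow> real2" where
  "ctr_tape c = (\<lambda>i. if i mod 10 = 0 then i = 0 else i div 10 < c (i mod 10))"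

abbreviation tm_quiet :: "instr list \<Rightarrow> config \<Rightarrow> config \<Rightarrow> bool" where
  "tm_quiet code \<equiv> quiet_step (step (tm code)) out0"

lemma tm_quiet_delta:
  assumes "st \<in> tstates (length code)"
    and "delta code st (z h) (s h) False = (st', z h, w, False, mv)"
    and "h' = (if mv then Suc h else h - 1)" "s' = s(h := w)"
  shows "tm_quiet code (enc st, h, z, s, blank) (enc st', h', z, s', blank)"
  using assms(2-) unfolding quiet_step_def step_tm[OF assms(1)]
  by (auto simp: out0_def ctape3_def)

lemma mod10_left: "(Suc h mod 10 + 9) mod 10 = h mod 10"
proof -
  have "(Suc h mod 10 + 9) mod 10 = (Suc h + 9) mod 10" by (rule mod_add_left_eq)
  also have "Suc h + 9 = h + 10" by simp
  finally show ?thesis by simp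
qed

lemma eq_10_times_plus_iff: "j < 10 \<Longrightarrow> i = 10 * b + j \<longleftrightarrow> i mod 10 = j \<and> i div 10 = b" for i :: nat
  using mult_div_mod_eq[of 10 i] by auto

context
  fixes code :: "instr list" and pc :: nat and z :: real2
  assumes ok: "ok_code code" and pc: "pc < length code"
begin

lemma ok_instr_at: "ok_instr (length code) (code ! pc)"
  using ok pc by (simp add: ok_code_def)

text \<open>In the blocks before block \<open>c j\<close> every cell of column \<open>j\<close>
  holds a one, so nothing stops the head earlier.\<close>

lemma tm_locate:
  assumes "reg (code ! pc) = j" "1 \<le> j" "j < 10" "h \<le> 10 * c j + j"
  shows "(tm_quiet code)\<^sup>*\<^sup>* (enc (W Loc pc 0), 0, z, ctr_tape c, blank)
    (enc (W Loc pc (h mod 10)), h, z, ctr_tape c, blank)"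
  using assms(4)
proof (induction h)
  case 0
  then show ?case by simp
next
  case (Suc h)
  have "ctr_tape c h" if "h mod 10 = j"
  proof -
    have "h div 10 < c j" using that Suc.prems by presburger
    then show ?thesis using that assms(2) by (simp add: ctr_tape_def)
  qed
  then have "tm_quiet code (enc (W Loc pc (h mod 10)), h, z, ctr_tape c, blank)
    (enc (W Loc pc (Suc h mod 10)), Suc h, z, ctr_tape c, blank)"
    using assms pc by (intro tm_quiet_delta[where w = "ctr_tape c h" and mv = True]) (auto simp: mod_Suc_eq)
  then show ?case using Suc by (simp add: rtranclp.rtrancl_into_rtrancl)
qed

lemma ctr_tape_0: "ctr_tape c 0"
  by (simp add: ctr_tape_def)

lemma tm_return:
  assumes "l < length code"
  shows "(tm_quiet code)\<^sup>*\<^sup>* (enc (W Ret l (h mod 10)), h, z, ctr_tape c, blank)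
    (enc (W Ex l 0), 0, z, ctr_tape c, blank)"
proof (induction h)
  case 0
  have "tm_quiet code (enc (W Ret l 0), 0, z, ctr_tape c, blank)
    (enc (W Ex l 0), 0, z, ctr_tape c, blank)"
    using assms ctr_tape_0[of c]
    by (intro tm_quiet_delta[where w = True and mv = False]) (auto simp: fun_upd_idem)
  then show ?case by simp
next
  case (Suc h)
  have "\<not> ctr_tape c (Suc h)" if "Suc h mod 10 = 0" using that by (simp add: ctr_tape_def)
  then have "tm_quiet code (enc (W Ret l (Suc h mod 10)), Suc h, z, ctr_tape c, blank)
    (enc (W Ret l (h mod 10)), h, z, ctr_tape c, blank)"
    using assms by (intro tm_quiet_delta[where w = "ctr_tape c (Suc h)" and mv = False])
      (auto simp: mod10_left)
  with Suc show ?case by (rule converse_rtranclp_into_rtranclp[rotated])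
qed

lemma tm_goto:
  assumes "(\<exists>l1 l0. code ! pc = Lt j r l1 l0) \<or> (\<exists>l1 l0. code ! pc = In j r l1 l0)"
    and "k < 10" "r < 10"
  shows "(tm_quiet code)\<^sup>*\<^sup>* (enc (W Goto pc k), 10 * b + k, z, ctr_tape c, blank)
    (enc (W Goto pc r), 10 * b + r, z, ctr_tape c, blank)"
proof (cases "k \<le> r")
  case True
  then show ?thesis using assms(2)
  proof (induction k rule: inc_induct)
    case base
    then show ?case by simp
  next
    case (step k)
    have "tm_quiet code (enc (W Goto pc k), 10 * b + k, z, ctr_tape c, blank)
      (enc (W Goto pc (Suc k)), 10 * b + Suc k, z, ctr_tape c, blank)"
      using step assms pc
      by (intro tm_quiet_delta[where w = "ctr_tape c (10 * b + k)" and mv = True]) auto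
    then show ?case using step assms(3) by (simp add: converse_rtranclp_into_rtranclp)
  qed
next
  case False
  then have "r \<le> k" by simp
  then show ?thesis using assms(2)
  proof (induction k rule: dec_induct)
    case base
    then show ?case by simp
  next
    case (step k)
    have "tm_quiet code (enc (W Goto pc (Suc k)), 10 * b + Suc k, z, ctr_tape c, blank)
      (enc (W Goto pc k), 10 * b + k, z, ctr_tape c, blank)"
      using step assms pc
      by (intro tm_quiet_delta[where w = "ctr_tape c (10 * b + Suc k)" and mv = False]) auto
    then show ?case using step by (simp add: converse_rtranclp_into_rtranclp)
  qed
qed

lemma tm_start_locate:
  assumes "code ! pc \<noteq> Halt" "\<nexists>l. code ! pc = Flash l"
  shows "tm_quiet code (enc (W Ex pc 0), 0, z, ctr_tape c, blank)
    (enc (W Loc pc 0), 0, z, ctr_tape c, blank)"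
  using assms pc
  by (intro tm_quiet_delta[where w = "ctr_tape c 0" and mv = False]) (auto split: instr.splits)

lemma ctr_tape_at: "1 \<le> j \<Longrightarrow> j < 10 \<Longrightarrow> ctr_tape c (10 * b + j) \<longleftrightarrow> b < c j"
  by (simp add: ctr_tape_def)

lemma ctr_tape_inc:
  assumes "1 \<le> j" "j < 10"
  shows "(ctr_tape c)(10 * c j + j := True) = ctr_tape (c(j := Suc (c j)))"
proof
  fix i
  show "((ctr_tape c)(10 * c j + j := True)) i = ctr_tape (c(j := Suc (c j))) i"
    using assms eq_10_times_plus_iff[of j i "c j"] by (auto simp: ctr_tape_def less_Suc_eq)
qed

lemma ctr_tape_dec:
  assumes "1 \<le> j" "j < 10" "c j = Suc b"
  shows "(ctr_tape c)(10 * b + j := False) = ctr_tape (c(j := c j - 1))"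
proof
  fix i
  show "((ctr_tape c)(10 * b + j := False)) i = ctr_tape (c(j := c j - 1)) i"
    using assms eq_10_times_plus_iff[of j i b] by (auto simp: ctr_tape_def less_Suc_eq)
qed

lemma tm_inc:
  assumes "code ! pc = Inc j l"
  shows "(tm_quiet code)\<^sup>+\<^sup>+ (enc (W Ex pc 0), 0, z, ctr_tape c, blank)
    (enc (W Ex l 0), 0, z, ctr_tape (c(j := Suc (c j))), blank)"
proof -
  have j: "1 \<le> j" "j < 10" "l < length code" using ok_instr_at assms by auto
  let ?h = "10 * c j + j" and ?c = "c(j := Suc (c j))"
  have 1: "tm_quiet code (enc (W Ex pc 0), 0, z, ctr_tape c, blank)
    (enc (W Loc pc 0), 0, z, ctr_tape c, blank)"
    using assms by (intro tm_start_locate) auto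
  have 2: "(tm_quiet code)\<^sup>*\<^sup>* (enc (W Loc pc 0), 0, z, ctr_tape c, blank)
    (enc (W Loc pc (?h mod 10)), ?h, z, ctr_tape c, blank)"
    using assms j by (intro tm_locate) auto
  have 3: "tm_quiet code (enc (W Loc pc (?h mod 10)), ?h, z, ctr_tape c, blank)
    (enc (W Ret l (Suc ?h mod 10)), Suc ?h, z, ctr_tape ?c, blank)"
    using assms j pc ctr_tape_at[of j c "c j"]
    by (intro tm_quiet_delta[where w = True and mv = True]) (auto simp: ctr_tape_inc mod_Suc_eq)
  have 4: "(tm_quiet code)\<^sup>*\<^sup>* (enc (W Ret l (Suc ?h mod 10)), Suc ?h, z, ctr_tape ?c, blank)
    (enc (W Ex l 0), 0, z, ctr_tape ?c, blank)"
    using j by (intro tm_return)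
  show ?thesis
    by (rule rtranclp_into_tranclp2[OF 1 rtranclp_trans[OF 2 converse_rtranclp_into_rtranclp[OF 3 4]]])
qed

text \<open>Here \<open>k - 1\<close> is the number of cells still to go. If the walk crosses column
  0, it does so at a positive multiple of 10, since \<open>j\<close> is at least 1; this cell is
  blank and is not mistaken for the marker.\<close>

lemma tm_back:
  assumes "code ! pc = Dec j l" "k \<le> 10" "k > 0"
  shows "(tm_quiet code)\<^sup>*\<^sup>* (enc (W Back pc ((j + k - 1) mod 10)), 10 * b + j + k - 1, z, ctr_tape c, blank)
    (enc (W Back pc j), 10 * b + j, z, ctr_tape c, blank)"
  using assms(2,3)
proof (induction k)
  case 0
  then show ?case by simp
next
  case (Suc k)
  have j: "1 \<le> j" "j < 10" using ok_instr_at assms by auto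
  show ?case
  proof (cases "k = 0")
    case True
    then show ?thesis using j by simp
  next
    case False
    have "(j + k) mod 10 \<noteq> j" using False Suc.prems j
      by (cases "j + k < 10") (auto simp: le_mod_geq)
    moreover have "((j + k) mod 10 + 9) mod 10 = (j + k - 1) mod 10"
      using mod10_left[of "j + k - 1"] j by simp
    moreover have "ctr_tape c (10 * b + j + k) = False" if "(j + k) mod 10 = 0"
    proof -
      have "(10 * b + j + k) mod 10 = 0" using that by (simp add: add.assoc)
      then show ?thesis using j by (simp add: ctr_tape_def)
    qed
    ultimately have "tm_quiet code (enc (W Back pc ((j + k) mod 10)), 10 * b + j + k, z, ctr_tape c, blank)
      (enc (W Back pc ((j + k - 1) mod 10)), 10 * b + j + k - 1, z, ctr_tape c, blank)"
      using assms pc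
      by (intro tm_quiet_delta[where w = "ctr_tape c (10 * b + j + k)" and mv = False]) auto
    then show ?thesis using Suc False by (simp add: converse_rtranclp_into_rtranclp)
  qed
qed

lemma tm_back_zero:
  assumes "code ! pc = Dec j l" "k < j"
  shows "(tm_quiet code)\<^sup>*\<^sup>* (enc (W Back pc k), k, z, ctr_tape c, blank)
    (enc (W Ex l 0), 0, z, ctr_tape c, blank)"
  using assms(2)
proof (induction k)
  case 0
  have "tm_quiet code (enc (W Back pc 0), 0, z, ctr_tape c, blank)
    (enc (W Ex l 0), 0, z, ctr_tape c, blank)"
    using assms pc ctr_tape_0[of c]
    by (intro tm_quiet_delta[where w = True and mv = False]) (auto simp: fun_upd_idem)
  then show ?case by simp
next
  case (Suc k)
  have "j < 10" using ok_instr_at assms by auto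
  then have "(Suc k + 9) mod 10 = k" "Suc k < 10" using Suc.prems by auto
  then have "tm_quiet code (enc (W Back pc (Suc k)), Suc k, z, ctr_tape c, blank)
    (enc (W Back pc k), k, z, ctr_tape c, blank)"
    using assms pc Suc.prems
    by (intro tm_quiet_delta[where w = "ctr_tape c (Suc k)" and mv = False]) auto
  then show ?case using Suc by (simp add: converse_rtranclp_into_rtranclp)
qed

lemma tm_dec:
  assumes "code ! pc = Dec j l"
  shows "(tm_quiet code)\<^sup>+\<^sup>+ (enc (W Ex pc 0), 0, z, ctr_tape c, blank)
    (enc (W Ex l 0), 0, z, ctr_tape (c(j := c j - 1)), blank)"
proof -
  have j: "1 \<le> j" "j < 10" "l < length code" using ok_instr_at assms by auto
  let ?h = "10 * c j + j" and ?c = "c(j := c j - 1)"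
  have 1: "tm_quiet code (enc (W Ex pc 0), 0, z, ctr_tape c, blank)
    (enc (W Loc pc 0), 0, z, ctr_tape c, blank)"
    using assms by (intro tm_start_locate) auto
  have 2: "(tm_quiet code)\<^sup>*\<^sup>* (enc (W Loc pc 0), 0, z, ctr_tape c, blank)
    (enc (W Loc pc (?h mod 10)), ?h, z, ctr_tape c, blank)"
    using assms j by (intro tm_locate) auto
  have 3: "tm_quiet code (enc (W Loc pc (?h mod 10)), ?h, z, ctr_tape c, blank)
    (enc (W Back pc (j - 1)), ?h - 1, z, ctr_tape c, blank)"
    using assms j pc ctr_tape_at[of j c "c j"]
    by (intro tm_quiet_delta[where w = False and mv = False]) (auto simp: fun_upd_idem)
  have 4: "(tm_quiet code)\<^sup>*\<^sup>* (enc (W Back pc (j - 1)), ?h - 1, z, ctr_tape c, blank)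
    (enc (W Ex l 0), 0, z, ctr_tape ?c, blank)"
  proof (cases "c j")
    case 0
    then have "?c = c" by auto
    then show ?thesis using tm_back_zero[OF assms, of "j - 1" c] j 0 by simp
  next
    case (Suc b)
    \<comment> \<open>The last one of the column is ten cells to the left of the first zero. One of
      these moves has been made already, and the other nine are the case \<open>k = 10\<close> of
      the walk back.\<close>
    have "j + 10 - 1 = (j - 1) + 10" using j by simp
    then have eq: "(j + 10 - 1) mod 10 = j - 1" "10 * b + j + 10 - 1 = ?h - 1"
      using j Suc by (simp_all only: mod_add_self2) auto
    have "(tm_quiet code)\<^sup>*\<^sup>* (enc (W Back pc (j - 1)), ?h - 1, z, ctr_tape c, blank)
      (enc (W Back pc j), 10 * b + j, z, ctr_tape c, blank)"
      using tm_back[OF assms, of 10 b c] unfolding eq by simp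
    moreover have "tm_quiet code (enc (W Back pc j), 10 * b + j, z, ctr_tape c, blank)
        (enc (W Ret l (Suc (10 * b + j) mod 10)), Suc (10 * b + j), z, ctr_tape ?c, blank)"
      using assms j pc Suc
      by (intro tm_quiet_delta[where w = False and mv = True]) (auto simp: ctr_tape_dec[of j c b] mod_Suc_eq)
    moreover have "(tm_quiet code)\<^sup>*\<^sup>* (enc (W Ret l (Suc (10 * b + j) mod 10)), Suc (10 * b + j), z, ctr_tape ?c, blank)
      (enc (W Ex l 0), 0, z, ctr_tape ?c, blank)"
      using j by (intro tm_return)
    ultimately show ?thesis by (meson converse_rtranclp_into_rtranclp rtranclp_trans)
  qed
  show ?thesis
    by (rule rtranclp_into_tranclp2[OF 1 rtranclp_trans[OF 2 converse_rtranclp_into_rtranclp[OF 3 4]]])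
qed

lemma tm_test:
  assumes "code ! pc = Lt j r l1 l0 \<and> v = (c j < c r) \<or>
      code ! pc = In j r l1 l0 \<and> v = z (10 * c j + r)"
  shows "(tm_quiet code)\<^sup>+\<^sup>+ (enc (W Ex pc 0), 0, z, ctr_tape c, blank)
    (enc (W Ex (if v then l1 else l0) 0), 0, z, ctr_tape c, blank)"
proof -
  have j: "1 \<le> j" "j < 10" "r < 10" "l1 < length code" "l0 < length code" "j \<noteq> r"
    using ok_instr_at assms by auto
  let ?h = "10 * c j + j" and ?g = "10 * c j + r" and ?l = "if v then l1 else l0"
  define k where "k = (if j < r then j + 1 else j - 1)"
  have 1: "tm_quiet code (enc (W Ex pc 0), 0, z, ctr_tape c, blank)
    (enc (W Loc pc 0), 0, z, ctr_tape c, blank)"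
    using assms by (intro tm_start_locate) auto
  have 2: "(tm_quiet code)\<^sup>*\<^sup>* (enc (W Loc pc 0), 0, z, ctr_tape c, blank)
    (enc (W Loc pc (?h mod 10)), ?h, z, ctr_tape c, blank)"
    using assms j by (intro tm_locate) auto
  have 3: "tm_quiet code (enc (W Loc pc (?h mod 10)), ?h, z, ctr_tape c, blank)
    (enc (W Goto pc k), 10 * c j + k, z, ctr_tape c, blank)"
  proof -
    have "delta code (W Loc pc j) x False False = (W Goto pc k, x, False, False, j < r)" for x
      using assms by (elim disjE conjE) (simp_all add: k_def)
    moreover have "\<not> ctr_tape c ?h" "?h mod 10 = j" using j by (simp_all add: ctr_tape_at)
    ultimately show ?thesis using j pc
      by (intro tm_quiet_delta[where w = False and mv = "j < r"]) (auto simp: k_def fun_upd_idem)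
  qed
  have 4: "(tm_quiet code)\<^sup>*\<^sup>* (enc (W Goto pc k), 10 * c j + k, z, ctr_tape c, blank)
     (enc (W Goto pc r), ?g, z, ctr_tape c, blank)"
    using assms j by (intro tm_goto) (auto simp: k_def)
  have 5: "tm_quiet code (enc (W Goto pc r), ?g, z, ctr_tape c, blank)
    (enc (W Ret ?l (Suc ?g mod 10)), Suc ?g, z, ctr_tape c, blank)"
  proof -
    have "ctr_tape c ?g = v" if "code ! pc = Lt j r l1 l0"
      using that assms ok_instr_at by (simp add: ctr_tape_at)
    then have "delta code (W Goto pc r) (z ?g) (ctr_tape c ?g) False =
        (W Ret ?l (Suc r mod 10), z ?g, ctr_tape c ?g, False, True)"
      using assms by (elim disjE conjE) simp_all
    moreover have "Suc ?g mod 10 = Suc r mod 10"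
      by (metis add_Suc_right mod_mult_self4)
    ultimately show ?thesis using j pc
      by (intro tm_quiet_delta[where w = "ctr_tape c ?g" and mv = True]) auto
  qed
  have 6: "(tm_quiet code)\<^sup>*\<^sup>* (enc (W Ret ?l (Suc ?g mod 10)), Suc ?g, z, ctr_tape c, blank)
    (enc (W Ex ?l 0), 0, z, ctr_tape c, blank)"
    using j by (intro tm_return) simp
  show ?thesis
    by (rule rtranclp_into_tranclp2[OF 1 rtranclp_trans[OF 2 converse_rtranclp_into_rtranclp[OF 3
          rtranclp_trans[OF 4 converse_rtranclp_into_rtranclp[OF 5 6]]]]])
qed

end

declare enc.simps [simp del]

text \<open>At \<open>Halt\<close> the counter program stays in place forever, while the machine
  goes on to its halting state, in which head and scratch tape no longer matter.\<close>

definition tm_sim :: "instr list \<Rightarrow> real2 \<Rightarrow> config \<Rightarrow> cmstate \<Rightarrow> bool" where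
  "tm_sim code z s a \<longleftrightarrow> fst a < length code \<and>
     (s = (enc (W Ex (fst a) 0), 0, z, ctr_tape (snd a), blank) \<or>
      code ! fst a = Halt \<and> (\<exists>h t. s = (enc Stop, h, z, t, blank)))"

lemma cmstep_closed:
  assumes "ok_code code" "fst a < length code"
  shows "fst (cmstep code z a) < length code"
proof -
  have "ok_instr (length code) (code ! fst a)" using assms by (simp add: ok_code_def)
  then show ?thesis using assms(2)
    by (cases a; cases "code ! fst a") (simp_all add: cmstep_def)
qed

lemma tm_sim_step:
  assumes "ok_code code" and sim: "tm_sim code z s a"
  shows "\<exists>t>0. tm_sim code z ((step (tm code) ^^ t) s) (cmstep code z a) \<and>
    ((\<exists>i<t. out0 ((step (tm code) ^^ i) s)) \<longleftrightarrow> at_flash code a)"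
proof -
  obtain pc c where a: "a = (pc, c)" by (cases a)
  have pc: "pc < length code" using sim a by (simp add: tm_sim_def)
  note closed = cmstep_closed[OF assms(1), of a z]
  consider (halt) "code ! pc = Halt" | (flash) l where "code ! pc = Flash l"
    | (other) "code ! pc \<noteq> Halt" "\<nexists>l. code ! pc = Flash l" by blast
  then show ?thesis
  proof cases
    case halt
    then obtain st h t where s: "s = (enc st, h, z, t, blank)" "st = W Ex pc 0 \<or> st = Stop"
      using sim a by (auto simp: tm_sim_def)
    have "\<exists>h' t'. step (tm code) s = (enc Stop, h', z, t', blank)"
      unfolding s(1) using s(2) halt pc by (subst step_tm) auto
    moreover have "\<not> out0 s" using s by (simp add: out0_def ctape3_def)
    ultimately show ?thesis using halt a pc
      by (intro exI[of _ 1]) (auto simp: tm_sim_def cmstep_def at_flash_def)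
  next
    case (flash l)
    then have s: "s = (enc (W Ex pc 0), 0, z, ctr_tape c, blank)"
      using sim a by (auto simp: tm_sim_def)
    have l: "l < length code" using closed flash a pc by (simp add: cmstep_def)
    have 1: "step (tm code) s = (enc (W Fl l 0), 0, z, ctr_tape c, blank(0 := True))"
      unfolding s using flash pc by (subst step_tm) auto
    have "step (tm code) (step (tm code) s) = (enc (W Ex l 0), 0, z, ctr_tape c, blank)"
      unfolding 1 using l by (subst step_tm) (auto simp: fun_upd_idem)
    then have "(step (tm code) ^^ 2) s = (enc (W Ex l 0), 0, z, ctr_tape c, blank)"
      by (simp add: numeral_2_eq_2)
    \<comment> \<open>The flag is up for one moment only, between the two steps.\<close>
    moreover have "\<exists>i<2. out0 ((step (tm code) ^^ i) s)"
      by (intro exI[of _ 1]) (simp add: 1 out0_def ctape3_def)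
    ultimately show ?thesis using flash a pc l
      by (intro exI[of _ 2]) (auto simp: tm_sim_def cmstep_def at_flash_def)
  next
    case other
    then have s: "s = (enc (W Ex pc 0), 0, z, ctr_tape c, blank)"
      using sim a by (auto simp: tm_sim_def)
    let ?a = "cmstep code z a"
    have "(tm_quiet code)\<^sup>+\<^sup>+ s (enc (W Ex (fst ?a) 0), 0, z, ctr_tape (snd ?a), blank)"
    proof (cases "code ! pc")
      case (Inc j l)
      show ?thesis unfolding s using tm_inc[OF assms(1) pc Inc] Inc a by (simp add: cmstep_def)
    next
      case (Dec j l)
      show ?thesis unfolding s using tm_dec[OF assms(1) pc Dec] Dec a by (simp add: cmstep_def)
    next
      case (Lt j r l1 l0)
      show ?thesis unfolding s using tm_test[OF assms(1) pc, of j r l1 l0 "c j < c r" c z] Lt a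
        by (simp add: cmstep_def)
    next
      case (In j r l1 l0)
      show ?thesis unfolding s using tm_test[OF assms(1) pc, of j r l1 l0 "z (10 * c j + r)" c z] In a
        by (simp add: cmstep_def)
    qed (use other in auto)
    then obtain t where t: "t > 0" "(step (tm code) ^^ t) s = (enc (W Ex (fst ?a) 0), 0, z, ctr_tape (snd ?a), blank)"
      "\<forall>i<t. \<not> out0 ((step (tm code) ^^ i) s)"
      using quiet_steps_funpow_pos by metis
    moreover have "\<not> at_flash code a" using other a by (simp add: at_flash_def)
    ultimately show ?thesis using closed a pc by (intro exI[of _ t]) (auto simp: tm_sim_def)
  qed
qed

text \<open>The simulation speaks about selected times, but the limsup of the output tape depends on
  all of them. This weaker invariant holds at every finite stage: the output is blank except for the
  raised flag in phase \<open>Fl\<close>, and it is blank when the machine stops.\<close>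

fun tm_inv :: "nat \<Rightarrow> tst \<Rightarrow> nat \<Rightarrow> real2 \<Rightarrow> real2 \<Rightarrow> bool" where
  "tm_inv L Start h s e \<longleftrightarrow> h = 0 \<and> s = blank \<and> e = blank"
| "tm_inv L Limit h s e \<longleftrightarrow> False"
| "tm_inv L Stop h s e \<longleftrightarrow> e = blank"
| "tm_inv L (W ph pc k) h s e \<longleftrightarrow> pc < L \<and> k = h mod 10 \<and> (\<forall>i. i mod 10 = 0 \<longrightarrow> s i = (i = 0)) \<and>
     (ph = Ex \<longrightarrow> h = 0) \<and> (if ph = Fl then h = 0 \<and> e = blank(0 := True) else e = blank)"

lemma tm_inv_delta:
  assumes ok: "ok_code code" and inv: "tm_inv (length code) st h s e"
    and d: "delta code st a (s h) (e h) = (st', w1, w2, w3, mv)"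
  shows "w1 = a \<and> tm_inv (length code) st' (if mv then Suc h else h - 1) (s(h := w2)) (e(h := w3))"
proof (cases st)
  case (W ph pc k)
  have pc: "pc < length code" and k: "k = h mod 10" and s: "\<And>i. i mod 10 = 0 \<Longrightarrow> s i = (i = 0)"
    using inv W by auto
  have oki: "ok_instr (length code) (code ! pc)" using ok pc by (simp add: ok_code_def)
  have left: "(h mod 10 + 9) mod 10 = (h - 1) mod 10" if "\<not> (h mod 10 = 0 \<and> s h)"
    using that s[of h] mod10_left[of "h - 1"] by (cases h) auto
  have pred: "h mod 10 - 1 = (h - 1) mod 10" if "h mod 10 \<noteq> 0"
    using that by (cases h) (auto simp: mod_Suc split: if_splits)
  show ?thesis
  proof (cases ph)
    case Ex
    then show ?thesis using d inv oki unfolding W by (cases "code ! pc") auto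
  next
    case Loc
    then show ?thesis using d inv oki pred unfolding W
      by (cases "code ! pc") (auto simp: mod_Suc split: if_splits)
  next
    case Goto
    then show ?thesis using d inv oki pred unfolding W
      by (cases "code ! pc") (auto simp: mod_Suc split: if_splits)
  next
    case Back
    show ?thesis
    proof (cases "\<exists>j l. code ! pc = Dec j l")
      case True
      then obtain j l where i: "code ! pc = Dec j l" by blast
      consider "h mod 10 = 0 \<and> s h" | "\<not> (h mod 10 = 0 \<and> s h)" "h mod 10 = j"
        | "\<not> (h mod 10 = 0 \<and> s h)" "h mod 10 \<noteq> j" by blast
      then show ?thesis
      proof cases
        case 1
        then show ?thesis using d inv oki i s[of h] unfolding W Back by auto
      next
        case 2
        then show ?thesis using d inv oki i mod_Suc_eq[of h 10] unfolding W Back by auto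
      next
        case 3
        from d 3 i k have "st' = W Back pc ((h - 1) mod 10)" "w1 = a" "w2 = s h" "w3 = e h" "\<not> mv"
          using left[OF 3(1)] unfolding W Back by (simp_all del: mod_add_left_eq)
        then show ?thesis using inv pc unfolding W Back by (simp add: fun_upd_idem)
      qed
    next
      case False
      then show ?thesis using d inv unfolding W Back by (cases "code ! pc") auto
    qed
  next
    case Ret
    show ?thesis
    proof (cases "h mod 10 = 0 \<and> s h")
      case True
      then show ?thesis using d inv s[of h] unfolding W Ret by auto
    next
      case False
      from d False k have "st' = W Ret pc ((h - 1) mod 10)" "w1 = a" "w2 = s h" "w3 = e h" "\<not> mv"
        using left[OF False] unfolding W Ret by (simp_all del: mod_add_left_eq)
      then show ?thesis using inv pc unfolding W Ret by (simp add: fun_upd_idem)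
    qed
  next
    case Fl
    then show ?thesis using d inv unfolding W by (auto simp: fun_upd_idem)
  qed
next
  case Start
  then show ?thesis using d inv ok by (auto simp: ok_code_def)
next
  case Stop
  then show ?thesis using d inv by auto
qed (use inv in auto)

lemma tm_orbit:
  assumes ok: "ok_code code"
  shows "\<exists>st h s e. (step (tm code) ^^ n) (initial z) = (enc st, h, z, s, e) \<and>
    tm_inv (length code) st h s e"
proof (induction n)
  case 0
  show ?case
    by (rule exI[of _ Start]) (simp add: initial_def q_start_def enc.simps)
next
  case (Suc n)
  then obtain st h s e where c: "(step (tm code) ^^ n) (initial z) = (enc st, h, z, s, e)"
    and inv: "tm_inv (length code) st h s e" by blast
  obtain st' w1 w2 w3 mv where d: "delta code st (z h) (s h) (e h) = (st', w1, w2, w3, mv)"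
    by (metis prod_cases5)
  have st: "st \<in> tstates (length code)" using inv by (cases st) auto
  show ?case using tm_inv_delta[OF ok inv d] d by (auto simp: c step_tm[OF st])
qed

lemma tm_orbit_output:
  assumes "ok_code code"
  shows "i \<noteq> 0 \<Longrightarrow> \<not> ctape3 ((step (tm code) ^^ n) (initial z)) i"
    and "cstate ((step (tm code) ^^ n) (initial z)) = q_halt \<Longrightarrow>
      ctape3 ((step (tm code) ^^ n) (initial z)) = blank"
proof -
  obtain st h s e where c: "(step (tm code) ^^ n) (initial z) = (enc st, h, z, s, e)"
    and inv: "tm_inv (length code) st h s e" using tm_orbit[OF assms] by blast
  show "\<not> ctape3 ((step (tm code) ^^ n) (initial z)) i" if "i \<noteq> 0"
    using inv that by (cases st) (auto simp: c ctape3_def split: if_splits)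
  show "ctape3 ((step (tm code) ^^ n) (initial z)) = blank"
    if "cstate ((step (tm code) ^^ n) (initial z)) = q_halt"
  proof -
    have "enc st = enc Stop" using that by (simp add: c cstate_def q_halt_def enc.simps)
    then show ?thesis using inv by (simp add: c ctape3_def enc_inject)
  qed
qed

lemma tm_halted_stays:
  assumes "cstate ((step (tm code) ^^ n) (initial z)) = q_halt"
  shows "cstate ((step (tm code) ^^ (n + m)) (initial z)) = q_halt"
proof (induction m)
  case 0
  then show ?case using assms by simp
next
  case (Suc m)
  obtain h a s e where c: "(step (tm code) ^^ (n + m)) (initial z) = (enc Stop, h, a, s, e)"
    using Suc by (metis cstate_def enc.simps(3) prod.collapse q_halt_def)
  show ?case by (simp add: c step_tm) (simp add: cstate_def q_halt_def enc.simps)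
qed

lemma recurs_tm:
  assumes "ok_code code"
  shows "recurs (step (tm code)) out0 (initial z) \<longleftrightarrow>
    recurs (cmstep code z) (at_flash code) (0, \<lambda>_. 0)"
proof -
  have "initial z = (enc Start, 0, z, blank, blank)" by (simp add: initial_def q_start_def enc.simps)
  moreover have "blank(0 := True) = ctr_tape (\<lambda>_. 0)" by (auto simp: ctr_tape_def fun_eq_iff)
  ultimately have "step (tm code) (initial z) = (enc (W Ex 0 0), 0, z, ctr_tape (\<lambda>_. 0), blank)"
    by (simp add: step_tm fun_upd_idem)
  \<comment> \<open>The first machine step merely plants the marker. Recurrence is not affected by a
    finite prefix, so the simulation may start at time 1.\<close>
  then have "tm_sim code z ((step (tm code) ^^ 1) (initial z)) (0, \<lambda>_. 0)"
    using assms by (simp add: tm_sim_def ok_code_def)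
  then have "recurs (step (tm code)) out0 ((step (tm code) ^^ 1) (initial z)) \<longleftrightarrow>
      recurs (cmstep code z) (at_flash code) (0, \<lambda>_. 0)"
    by (rule recurs_simulation) (rule tm_sim_step[OF assms])
  then show ?thesis by (simp only: recurs_funpow)
qed

text \<open>After a halt at a finite stage the flag is never raised again, and the output is blank.
  Otherwise stage omega is reached with output cell 0 equal to 1 iff the flag was raised infinitely
  often, and the machine stops at omega + 1, which is below omega^2.\<close>

lemma tm_correct:
  assumes "ok_code code"
  shows "halts_before (tm code) z (omega_pow 2)"
    and "accepts (tm code) z \<longleftrightarrow> recurs (cmstep code z) (at_flash code) (0, \<lambda>_. 0)"
proof -
  let ?c = "\<lambda>n. (step (tm code) ^^ n) (initial z)"
  have "\<exists>a c. halts_at (tm code) z a c \<and> olt a (omega_pow 2) \<and>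
    (ctape3 c = yes_real \<longleftrightarrow> recurs (step (tm code)) out0 (initial z))"
  proof (cases "\<exists>n. cstate (?c n) = q_halt")
    case True
    then obtain n where n: "cstate (?c n) = q_halt" "\<And>i. i < n \<Longrightarrow> cstate (?c i) \<noteq> q_halt"
      using exists_least_iff[of "\<lambda>n. cstate (?c n) = q_halt"] by blast
    have "olt (fin_ord n) (omega_pow 2)"
      unfolding olt_def by (intro exI[of _ 2]) (auto simp: fin_ord_def omega_pow_def ozero_app)
    moreover have "\<not> out0 (?c i)" if "i \<ge> n" for i
      using tm_orbit_output(2)[OF assms, of i z] tm_halted_stays[OF n(1), of "i - n"] that
      by (simp add: out0_def)
    then have "\<not> recurs (step (tm code)) out0 (initial z)"
      unfolding recurs_def INFM_nat_le by blast
    moreover have "ctape3 (?c n) \<noteq> yes_real"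
      using tm_orbit_output(2)[OF assms n(1)] by (auto simp: yes_real_def fun_eq_iff)
    ultimately show ?thesis using halts_at_finite[OF n] by blast
  next
    case False
    let ?l = "limit_of_orbit (tm code) (initial z)"
    have "step (tm code) (enc Limit, 0, t1, t2, t3) = (enc Stop, 0, t1, t2, t3)" for t1 t2 t3
      by (simp add: step_tm)
    moreover have "?l = (enc Limit, 0, ctape1 ?l, ctape2 ?l, ctape3 ?l)"
      by (simp add: limit_of_orbit_def ctape1_def ctape2_def ctape3_def q_limit_def enc.simps)
    ultimately have l: "step (tm code) ?l = (enc Stop, 0, ctape1 ?l, ctape2 ?l, ctape3 ?l)"
      by metis
    have halt: "halts_at (tm code) z (osuc (omega_pow 1)) (step (tm code) ?l)"
      by (rule halts_at_omega) (use False in \<open>simp_all add: l cstate_def q_halt_def enc.simps\<close>)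
    have lt: "olt (osuc (omega_pow 1)) (omega_pow 2)"
      unfolding olt_def by (intro exI[of _ 2]) (auto simp: osuc_def omega_pow_def)
    have "ctape3 (step (tm code) ?l) i \<longleftrightarrow> (\<exists>\<^sub>\<infinity>n. ctape3 (?c n) i)" for i
      by (simp add: l) (simp add: ctape3_def limit_of_orbit_def)
    moreover have "\<not> (\<exists>\<^sub>\<infinity>n. ctape3 (?c n) i)" if "i \<noteq> 0" for i
      using tm_orbit_output(1)[OF assms that] by simp
    ultimately have "ctape3 (step (tm code) ?l) = yes_real \<longleftrightarrow> recurs (step (tm code)) out0 (initial z)"
      unfolding fun_eq_iff yes_real_def recurs_def out0_def by metis
    with halt lt show ?thesis by blast
  qed
  then obtain a c where ac: "halts_at (tm code) z a c" "olt a (omega_pow 2)"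
    "ctape3 c = yes_real \<longleftrightarrow> recurs (step (tm code)) out0 (initial z)" by blast
  then show "halts_before (tm code) z (omega_pow 2)" unfolding halts_before_def by blast
  have "accepts (tm code) z \<longleftrightarrow> ctape3 c = yes_real"
    unfolding accepts_def using ac(1) halts_at_unique by blast
  then show "accepts (tm code) z \<longleftrightarrow> recurs (cmstep code z) (at_flash code) (0, \<lambda>_. 0)"
    using ac(3) recurs_tm[OF assms] by simp
qed

section \<open>The verifier\<close>

abbreviation cm_quiet :: "instr list \<Rightarrow> real2 \<Rightarrow> cmstate \<Rightarrow> cmstate \<Rightarrow> bool" where
  "cm_quiet code z \<equiv> quiet_step (cmstep code z) (at_flash code)"

lemma cm_quiet_exec:
  assumes "code ! p = i" "\<nexists>l. i = Flash l"
  shows "(cm_quiet code z)\<^sup>*\<^sup>* (p, c) (exec z i (p, c))"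
  using assms by (intro r_into_rtranclp) (simp add: quiet_step_def cmstep_def at_flash_def)

lemma cm_clear:
  assumes "code ! p = Lt z0 j q e" "code ! q = Dec j p" "z0 \<noteq> j" "c z0 = 0"
  shows "(cm_quiet code z)\<^sup>*\<^sup>* (p, c) (e, c(j := 0))"
  using assms(4)
proof (induction "c j" arbitrary: c)
  case 0
  then have "c(j := 0) = c" by auto
  then show ?case using cm_quiet_exec[OF assms(1), of z c] 0 by simp
next
  case (Suc n)
  have "(cm_quiet code z)\<^sup>*\<^sup>* (p, c) (q, c)"
    using cm_quiet_exec[OF assms(1), of z c] Suc by simp
  moreover have "(cm_quiet code z)\<^sup>*\<^sup>* (q, c) (p, c(j := c j - 1))"
    using cm_quiet_exec[OF assms(2), of z c] by simp
  moreover have "(cm_quiet code z)\<^sup>*\<^sup>* (p, c(j := c j - 1)) (e, c(j := 0))"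
    using Suc(1)[of "c(j := c j - 1)"] Suc(2,3) assms(3) by simp
  ultimately show ?case by (meson rtranclp_trans)
qed

lemma cm_copy:
  assumes "code ! p = Lt j k q e" "code ! q = Inc j p" "j \<noteq> k" "c j \<le> c k"
  shows "(cm_quiet code z)\<^sup>*\<^sup>* (p, c) (e, c(j := c k))"
  using assms(4)
proof (induction "c k - c j" arbitrary: c)
  case 0
  then have "c(j := c k) = c" by auto
  then show ?case using cm_quiet_exec[OF assms(1), of z c] 0 by simp
next
  case (Suc n)
  then have "c j < c k" by linarith
  then have "(cm_quiet code z)\<^sup>*\<^sup>* (p, c) (q, c)"
    using cm_quiet_exec[OF assms(1), of z c] by simp
  moreover have "(cm_quiet code z)\<^sup>*\<^sup>* (q, c) (p, c(j := Suc (c j)))"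
    using cm_quiet_exec[OF assms(2), of z c] by simp
  moreover have "(cm_quiet code z)\<^sup>*\<^sup>* (p, c(j := Suc (c j))) (e, c(j := c k))"
    using Suc(1)[of "c(j := Suc (c j))"] Suc(2,3) assms(3) by simp
  ultimately show ?case by (meson rtranclp_trans)
qed

text \<open>Besides transferring a value this undoes a halving, by adding one half to the
  other.\<close>

lemma cm_move:
  assumes "code ! p = Lt z0 j q e" "code ! q = Dec j q'" "code ! q' = Inc k p"
    and "distinct [z0, j, k]" "c z0 = 0"
  shows "(cm_quiet code z)\<^sup>*\<^sup>* (p, c) (e, c(j := 0, k := c k + c j))"
  using assms(5)
proof (induction "c j" arbitrary: c)
  case 0
  then have "c(j := 0, k := c k + c j) = c" by auto
  moreover have "(cm_quiet code z)\<^sup>*\<^sup>* (p, c) (e, c)"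
    using cm_quiet_exec[OF assms(1), of z c] 0 by simp
  ultimately show ?case by metis
next
  case (Suc n)
  let ?c = "c(j := c j - 1, k := Suc (c k))"
  have "(cm_quiet code z)\<^sup>*\<^sup>* (p, c) (q, c)"
    using cm_quiet_exec[OF assms(1), of z c] Suc by simp
  moreover have "(cm_quiet code z)\<^sup>*\<^sup>* (q, c) (q', c(j := c j - 1))"
    using cm_quiet_exec[OF assms(2), of z c] by simp
  moreover have "(cm_quiet code z)\<^sup>*\<^sup>* (q', c(j := c j - 1)) (p, ?c)"
    using cm_quiet_exec[OF assms(3), of z "c(j := c j - 1)"] assms(4) by simp
  moreover have "?c(j := 0, k := ?c k + ?c j) = c(j := 0, k := c k + c j)"
    using Suc(2) assms(4) by (auto simp: fun_eq_iff)
  then have "(cm_quiet code z)\<^sup>*\<^sup>* (p, ?c) (e, c(j := 0, k := c k + c j))"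
    using Suc(1)[of ?c] Suc(2,3) assms(4) by auto
  ultimately show ?case by (meson rtranclp_trans)
qed

text \<open>Both ends move towards the middle, which leaves the two halves of the initial value.\<close>

lemma cm_halve:
  assumes "code ! p = Lt t j q e" "code ! q = Inc t q'" "code ! q' = Dec j p"
    and "t \<noteq> j" "c t = 0"
  shows "(cm_quiet code z)\<^sup>*\<^sup>* (p, c) (e, c(j := c j div 2, t := Suc (c j) div 2))"
proof -
  have "(cm_quiet code z)\<^sup>*\<^sup>* (p, c) (e, c(j := (c t + c j) div 2, t := Suc (c t + c j) div 2))"
    if "c t \<le> Suc (c j)" for c
    using that
  proof (induction "c j - c t" arbitrary: c rule: less_induct)
    case less
    show ?case
    proof (cases "c t < c j")
      case False
      then have "(c t + c j) div 2 = c j" "Suc (c t + c j) div 2 = c t" using less.prems by auto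
      then have "c(j := (c t + c j) div 2, t := Suc (c t + c j) div 2) = c" using assms(4) by auto
      then show ?thesis using cm_quiet_exec[OF assms(1), of z c] False by simp
    next
      case True
      let ?c = "c(t := Suc (c t), j := c j - 1)"
      have "(cm_quiet code z)\<^sup>*\<^sup>* (p, c) (q, c)"
        using cm_quiet_exec[OF assms(1), of z c] True by simp
      moreover have "(cm_quiet code z)\<^sup>*\<^sup>* (q, c) (q', c(t := Suc (c t)))"
        using cm_quiet_exec[OF assms(2), of z c] by simp
      moreover have "(cm_quiet code z)\<^sup>*\<^sup>* (q', c(t := Suc (c t))) (p, ?c)"
        using cm_quiet_exec[OF assms(3), of z "c(t := Suc (c t))"] assms(4) by simp
      moreover have "?c t + ?c j = c t + c j" using True assms(4) by simp
      then have "?c(j := (?c t + ?c j) div 2, t := Suc (?c t + ?c j) div 2) =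
          c(j := (c t + c j) div 2, t := Suc (c t + c j) div 2)"
        using assms(4) by (simp only:) (auto simp: fun_eq_iff)
      then have "(cm_quiet code z)\<^sup>*\<^sup>* (p, ?c) (e, c(j := (c t + c j) div 2, t := Suc (c t + c j) div 2))"
        using less.hyps[of ?c] True assms(4) by auto
      ultimately show ?thesis by (meson rtranclp_trans)
    qed
  qed
  from this[of c] assms(5) show ?thesis by simp
qed

text \<open>The counters 2 to 9 are named k, n, m, i, a, b, t, r; counter 1 is always zero. The guess for
  the value of gate n is read at position 10 n + 1, the bit for the wire from m to n at position 10 i, where i
  is the code of (m, n). Gate k is the next one for which a certificate has to be found: either gate k
  is guessed to be true, or some m is an input of it that is guessed to be true. From instruction 10 to
  instruction 47, r receives the comparison of m and n, which are consumed in the copies b and a.\<close>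

definition verifier :: "bool \<Rightarrow> instr list" where
  "verifier v = [
    Lt 1 3 2 1, In 3 1 (if v then 2 else 46) (if v then 46 else 2),
    Lt 7 4 3 4, Inc 7 2, Lt 1 7 5 52, Lt 6 3 6 7, Inc 6 5, Lt 1 6 10 8, Lt 1 7 9 49, Dec 7 8,
    Lt 1 7 12 11, Lt 1 6 12 47,
    Lt 8 7 13 15, Inc 8 14, Dec 7 12, Lt 7 8 16 28,
    Lt 1 8 17 18, Dec 8 16, Lt 8 6 19 21, Inc 8 20, Dec 6 18, Lt 6 8 22 24,
    Lt 1 8 23 10, Dec 8 22, Lt 1 8 25 27, Dec 8 26, Inc 6 24, Dec 9 10,
    Lt 1 8 29 31, Dec 8 30, Inc 7 28, Lt 8 6 32 34, Inc 8 33, Dec 6 31, Lt 6 8 35 39,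
    Lt 1 8 36 37, Dec 8 35, Dec 9 38, Inc 9 10,
    Lt 1 8 40 41, Dec 8 39, Lt 8 7 42 44, Inc 8 43, Dec 7 41, Lt 1 8 45 10, Dec 8 44,
    Halt,
    Lt 1 9 48 52, Dec 9 49, In 5 0 50 52, In 4 1 51 52, In 3 1 46 53,
    In 3 1 53 60, Lt 3 2 60 54, Lt 2 3 60 55,
    Flash 56, Inc 2 57, Lt 1 3 58 59, Dec 3 57, Lt 1 4 66 67,
    Inc 5 61, Lt 1 3 62 64, Dec 3 63, Inc 4 0, Inc 3 65, Lt 1 4 69 0,
    Dec 4 59, Lt 1 5 68 0, Dec 5 67, Dec 4 70, Inc 3 65]"

lemma ok_verifier: "ok_code (verifier v)"
  by (simp add: ok_code_def verifier_def)

text \<open>The argument list starts with counter 2. The missing counter 1 is 0, so that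
  \<open>Lt 1 j\<close> tests whether counter \<open>j\<close> is nonzero.\<close>

definition ctr :: "nat \<Rightarrow> nat \<Rightarrow> nat \<Rightarrow> nat \<Rightarrow> nat \<Rightarrow> nat \<Rightarrow> nat \<Rightarrow> nat \<Rightarrow> nat \<Rightarrow> nat" where
  "ctr k n m i a b t r = (\<lambda>_. 0)(2 := k, 3 := n, 4 := m, 5 := i, 6 := a, 7 := b, 8 := t, 9 := r)"

lemma ctr_simps [simp]:
  "ctr k n m i a b t r (Suc 0) = 0" "ctr k n m i a b t r 2 = k" "ctr k n m i a b t r 3 = n"
  "ctr k n m i a b t r 4 = m" "ctr k n m i a b t r 5 = i" "ctr k n m i a b t r 6 = a"
  "ctr k n m i a b t r 7 = b" "ctr k n m i a b t r 8 = t" "ctr k n m i a b t r 9 = r"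
  "(ctr k n m i a b t r)(2 := u) = ctr u n m i a b t r"
  "(ctr k n m i a b t r)(3 := u) = ctr k u m i a b t r"
  "(ctr k n m i a b t r)(4 := u) = ctr k n u i a b t r"
  "(ctr k n m i a b t r)(5 := u) = ctr k n m u a b t r"
  "(ctr k n m i a b t r)(6 := u) = ctr k n m i u b t r"
  "(ctr k n m i a b t r)(7 := u) = ctr k n m i a u t r"
  "(ctr k n m i a b t r)(8 := u) = ctr k n m i a b u r"
  "(ctr k n m i a b t r)(9 := u) = ctr k n m i a b t u"
  by (auto simp: ctr_def fun_eq_iff)

text \<open>The number 0 represents the root instead of the ordinal 0.\<close>

definition below :: "nat \<Rightarrow> nat \<Rightarrow> bool" where
  "below m n \<longleftrightarrow> m \<noteq> 0 \<and> (n = 0 \<or> olt (ord_of m) (ord_of n))"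

section \<open>Execution of the verifier\<close>

context
  fixes v :: bool and z :: real2
begin

abbreviation vreach :: "cmstate \<Rightarrow> cmstate \<Rightarrow> bool" where
  "vreach \<equiv> (cm_quiet (verifier v) z)\<^sup>*\<^sup>*"

lemma vstep:
  assumes "verifier v ! p = i" "\<nexists>l. i = Flash l" "exec z i (p, c) = s"
  shows "vreach (p, c) s"
  using cm_quiet_exec[OF assms(1,2)] assms(3) by metis

lemmas vtrans = rtranclp_trans[of "cm_quiet (verifier v) z"]

text \<open>Halving leaves the lower half in the counter and the upper half in t, so a comparison of
  the two reveals the parity.\<close>

lemma odd_halves: "n div 2 < Suc n div 2 \<longleftrightarrow> odd n"
  by presburger

lemma add_halves: "n div 2 + Suc n div 2 = n" "Suc n div 2 + n div 2 = n"
  by presburger+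

text \<open>Entered after an odd \<open>b\<close> has been replaced by its lower half. If
  \<open>a\<close> is odd as well, both ordinals have lost a successor. If \<open>a\<close> is even,
  it is restored from its halves, and the verdict for equality becomes False.\<close>

lemma vcompare_odd:
  "vreach (16, ctr k n m i a b t r)
     (10, if odd a then ctr k n m i (a div 2) b 0 r else ctr k n m i a b 0 0)"
  if "r \<le> 1"
proof -
  have 1: "vreach (16, ctr k n m i a b t r) (18, ctr k n m i a b 0 r)"
    using cm_clear[of "verifier v" 16 1 8 17 18 "ctr k n m i a b t r" z] by (simp add: verifier_def)
  have 2: "vreach (18, ctr k n m i a b 0 r) (21, ctr k n m i (a div 2) b (Suc a div 2) r)"
    using cm_halve[of "verifier v" 18 8 6 19 21 20 "ctr k n m i a b 0 r" z] by (simp add: verifier_def)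
  have 3: "vreach (21, ctr k n m i (a div 2) b (Suc a div 2) r)
     (if odd a then 22 else 24, ctr k n m i (a div 2) b (Suc a div 2) r)"
    by (rule vstep[where i = "Lt 6 8 22 24"]) (simp_all add: verifier_def odd_halves)
  have 4: "vreach (22, ctr k n m i (a div 2) b (Suc a div 2) r) (10, ctr k n m i (a div 2) b 0 r)"
    using cm_clear[of "verifier v" 22 1 8 23 10 "ctr k n m i (a div 2) b (Suc a div 2) r" z]
    by (simp add: verifier_def)
  have 5: "vreach (24, ctr k n m i (a div 2) b (Suc a div 2) r) (27, ctr k n m i a b 0 r)"
    using cm_move[of "verifier v" 24 1 8 25 27 26 6 "ctr k n m i (a div 2) b (Suc a div 2) r" z]
    by (simp add: verifier_def add_halves)
  have 6: "vreach (27, ctr k n m i a b 0 r) (10, ctr k n m i a b 0 0)"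
    by (rule vstep[where i = "Dec 9 10"]) (use that in \<open>simp_all add: verifier_def\<close>)
  note 123 = vtrans[OF 1 vtrans[OF 2 3]]
  show ?thesis
  proof (cases "odd a")
    case True
    then show ?thesis using vtrans[OF 123, of "(10, ctr k n m i (a div 2) b 0 r)"] 4 by simp
  next
    case False
    then show ?thesis using vtrans[OF 123, of "(10, ctr k n m i a b 0 0)"] vtrans[OF 5 6] by simp
  qed
qed

text \<open>Whether an even \<open>b\<close> may be halved depends on \<open>a\<close>, so it is
  first put together again. An odd \<open>a\<close> gives up its last bit alone and turns the
  verdict for equality to True.\<close>

lemma vcompare_even:
  "vreach (28, ctr k n m i a (b div 2) (Suc b div 2) r)
     (10, if odd a then ctr k n m i (a div 2) b 0 1 else ctr k n m i (a div 2) (b div 2) 0 r)"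
  if "r \<le> 1"
proof -
  have 1: "vreach (28, ctr k n m i a (b div 2) (Suc b div 2) r) (31, ctr k n m i a b 0 r)"
    using cm_move[of "verifier v" 28 1 8 29 31 30 7 "ctr k n m i a (b div 2) (Suc b div 2) r" z]
    by (simp add: verifier_def add_halves)
  have 2: "vreach (31, ctr k n m i a b 0 r) (34, ctr k n m i (a div 2) b (Suc a div 2) r)"
    using cm_halve[of "verifier v" 31 8 6 32 34 33 "ctr k n m i a b 0 r" z] by (simp add: verifier_def)
  have 3: "vreach (34, ctr k n m i (a div 2) b (Suc a div 2) r)
     (if odd a then 35 else 39, ctr k n m i (a div 2) b (Suc a div 2) r)"
    by (rule vstep[where i = "Lt 6 8 35 39"]) (simp_all add: verifier_def odd_halves)
  have 4: "vreach (35, ctr k n m i (a div 2) b (Suc a div 2) r) (37, ctr k n m i (a div 2) b 0 r)"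
    using cm_clear[of "verifier v" 35 1 8 36 37 "ctr k n m i (a div 2) b (Suc a div 2) r" z]
    by (simp add: verifier_def)
  have 5: "vreach (37, ctr k n m i (a div 2) b 0 r) (38, ctr k n m i (a div 2) b 0 0)"
    by (rule vstep[where i = "Dec 9 38"]) (use that in \<open>simp_all add: verifier_def\<close>)
  have 6: "vreach (38, ctr k n m i (a div 2) b 0 0) (10, ctr k n m i (a div 2) b 0 1)"
    by (rule vstep[where i = "Inc 9 10"]) (simp_all add: verifier_def)
  have 7: "vreach (39, ctr k n m i (a div 2) b (Suc a div 2) r) (41, ctr k n m i (a div 2) b 0 r)"
    using cm_clear[of "verifier v" 39 1 8 40 41 "ctr k n m i (a div 2) b (Suc a div 2) r" z]
    by (simp add: verifier_def)
  have 8: "vreach (41, ctr k n m i (a div 2) b 0 r) (44, ctr k n m i (a div 2) (b div 2) (Suc b div 2) r)"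
    using cm_halve[of "verifier v" 41 8 7 42 44 43 "ctr k n m i (a div 2) b 0 r" z]
    by (simp add: verifier_def)
  have 9: "vreach (44, ctr k n m i (a div 2) (b div 2) (Suc b div 2) r)
      (10, ctr k n m i (a div 2) (b div 2) 0 r)"
    using cm_clear[of "verifier v" 44 1 8 45 10 "ctr k n m i (a div 2) (b div 2) (Suc b div 2) r" z]
    by (simp add: verifier_def)
  note 123 = vtrans[OF 1 vtrans[OF 2 3]]
  show ?thesis
  proof (cases "odd a")
    case True
    then show ?thesis using vtrans[OF 123, of "(10, ctr k n m i (a div 2) b 0 1)"]
        vtrans[OF 4 vtrans[OF 5 6]] by simp
  next
    case False
    then show ?thesis using vtrans[OF 123, of "(10, ctr k n m i (a div 2) (b div 2) 0 r)"]
        vtrans[OF 7 vtrans[OF 8 9]] by simp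
  qed
qed

lemma vcompare_round:
  assumes "b \<noteq> 0 \<or> a \<noteq> 0" "r \<le> 1"
  shows "vreach (10, ctr k n m i a b 0 r)
    (10, if odd b then (if odd a then ctr k n m i (a div 2) (b div 2) 0 r else ctr k n m i a (b div 2) 0 0)
         else (if odd a then ctr k n m i (a div 2) b 0 1 else ctr k n m i (a div 2) (b div 2) 0 r))"
proof -
  have 1: "vreach (10, ctr k n m i a b 0 r) (if b = 0 then 11 else 12, ctr k n m i a b 0 r)"
    by (rule vstep[where i = "Lt 1 7 12 11"]) (simp_all add: verifier_def)
  have 2: "vreach (11, ctr k n m i a b 0 r) (if a = 0 then 47 else 12, ctr k n m i a b 0 r)"
    by (rule vstep[where i = "Lt 1 6 12 47"]) (simp_all add: verifier_def)
  have 3: "vreach (12, ctr k n m i a b 0 r) (15, ctr k n m i a (b div 2) (Suc b div 2) r)"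
    using cm_halve[of "verifier v" 12 8 7 13 15 14 "ctr k n m i a b 0 r" z] by (simp add: verifier_def)
  have 4: "vreach (15, ctr k n m i a (b div 2) (Suc b div 2) r)
    (if odd b then 16 else 28, ctr k n m i a (b div 2) (Suc b div 2) r)"
    by (rule vstep[where i = "Lt 7 8 16 28"]) (simp_all add: verifier_def odd_halves)
  have "vreach (10, ctr k n m i a b 0 r) (12, ctr k n m i a b 0 r)"
    using 1 2 vtrans[OF 1, of "(12, ctr k n m i a b 0 r)"] assms(1) by (cases "b = 0") auto
  note 1234 = vtrans[OF this vtrans[OF 3 4]]
  show ?thesis
  proof (cases "odd b")
    case True
    then have "vreach (10, ctr k n m i a b 0 r) (16, ctr k n m i a (b div 2) (Suc b div 2) r)"
      using 1234 by simp
    from vtrans[OF this vcompare_odd[OF assms(2)]] show ?thesis using True by simp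
  next
    case False
    then have "vreach (10, ctr k n m i a b 0 r) (28, ctr k n m i a (b div 2) (Suc b div 2) r)"
      using 1234 by simp
    from vtrans[OF this vcompare_even[OF assms(2)]] show ?thesis using False by simp
  qed
qed

lemma vcompare:
  "vreach (10, ctr k n m i a b 0 (of_bool r)) (47, ctr k n m i 0 0 0 (of_bool (cmp r b a)))"
proof (induction r b a rule: cmp.induct)
  case (1 r b a)
  show ?case
  proof (cases "b = 0 \<and> a = 0")
    case True
    have "vreach (10, ctr k n m i 0 0 0 (of_bool r)) (11, ctr k n m i 0 0 0 (of_bool r))"
      by (rule vstep[where i = "Lt 1 7 12 11"]) (simp_all add: verifier_def)
    moreover have "vreach (11, ctr k n m i 0 0 0 (of_bool r)) (47, ctr k n m i 0 0 0 (of_bool r))"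
      by (rule vstep[where i = "Lt 1 6 12 47"]) (simp_all add: verifier_def)
    ultimately have "vreach (10, ctr k n m i 0 0 0 (of_bool r)) (47, ctr k n m i 0 0 0 (of_bool r))"
      by (rule vtrans)
    then show ?thesis using True by (simp add: cmp.simps)
  next
    case False
    note round = vcompare_round[of b a "of_bool r" k n m i]
    consider "odd b" "odd a" | "odd b" "even a" | "even b" "odd a" | "even b" "even a" by blast
    then show ?thesis
    proof cases
      case 1
      then have A: "vreach (10, ctr k n m i a b 0 (of_bool r)) (10, ctr k n m i (a div 2) (b div 2) 0 (of_bool r))"
        using round False by simp
      have eq: "cmp r b a = cmp r (b div 2) (a div 2)"
        using 1 False by (auto simp: cmp.simps[of r b a])
      have B: "vreach (10, ctr k n m i (a div 2) (b div 2) 0 (of_bool r)) (47, ctr k n m i 0 0 0 (of_bool (cmp r (b div 2) (a div 2))))"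
        by (rule "1.IH"(1)) (use 1 False in auto)
      show ?thesis unfolding eq by (rule vtrans[OF A B])
    next
      case 2
      then have A: "vreach (10, ctr k n m i a b 0 (of_bool r)) (10, ctr k n m i a (b div 2) 0 (of_bool False))"
        using round False by simp
      have eq: "cmp r b a = cmp False (b div 2) a"
        using 2 False by (auto simp: cmp.simps[of r b a])
      have B: "vreach (10, ctr k n m i a (b div 2) 0 (of_bool False)) (47, ctr k n m i 0 0 0 (of_bool (cmp False (b div 2) a)))"
        by (rule "1.IH"(2)) (use 2 False in auto)
      show ?thesis unfolding eq by (rule vtrans[OF A B])
    next
      case 3
      then have A: "vreach (10, ctr k n m i a b 0 (of_bool r)) (10, ctr k n m i (a div 2) b 0 (of_bool True))"
        using round False by simp
      have eq: "cmp r b a = cmp True b (a div 2)"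
        using 3 False by (auto simp: cmp.simps[of r b a])
      have B: "vreach (10, ctr k n m i (a div 2) b 0 (of_bool True)) (47, ctr k n m i 0 0 0 (of_bool (cmp True b (a div 2))))"
        by (rule "1.IH"(3)) (use 3 False in auto)
      show ?thesis unfolding eq by (rule vtrans[OF A B])
    next
      case 4
      then have A: "vreach (10, ctr k n m i a b 0 (of_bool r)) (10, ctr k n m i (a div 2) (b div 2) 0 (of_bool r))"
        using round False by simp
      have eq: "cmp r b a = cmp r (b div 2) (a div 2)"
        using 4 False by (auto simp: cmp.simps[of r b a])
      have B: "vreach (10, ctr k n m i (a div 2) (b div 2) 0 (of_bool r)) (47, ctr k n m i 0 0 0 (of_bool (cmp r (b div 2) (a div 2))))"
        by (rule "1.IH"(4)) (use 4 False in auto)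
      show ?thesis unfolding eq by (rule vtrans[OF A B])
    qed
  qed
qed

text \<open>Since 0 stands for the root, both numbers are tested for 0 before the ordinals are
  compared. Each exit leaves the working counters at 0, ready for the next pair.\<close>

lemma vbelow:
  "vreach (2, ctr k n m i 0 0 0 0) (if below m n then 49 else 52, ctr k n m i 0 0 0 0)"
proof -
  have 1: "vreach (2, ctr k n m i 0 0 0 0) (4, ctr k n m i 0 m 0 0)"
    using cm_copy[of "verifier v" 2 7 4 3 4 "ctr k n m i 0 0 0 0" z] by (simp add: verifier_def)
  have 2: "vreach (4, ctr k n m i 0 m 0 0) (if m = 0 then 52 else 5, ctr k n m i 0 m 0 0)"
    by (rule vstep[where i = "Lt 1 7 5 52"]) (simp_all add: verifier_def)
  have 3: "vreach (5, ctr k n m i 0 m 0 0) (7, ctr k n m i n m 0 0)"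
    using cm_copy[of "verifier v" 5 6 3 6 7 "ctr k n m i 0 m 0 0" z] by (simp add: verifier_def)
  have 4: "vreach (7, ctr k n m i n m 0 0) (if n = 0 then 8 else 10, ctr k n m i n m 0 0)"
    by (rule vstep[where i = "Lt 1 6 10 8"]) (simp_all add: verifier_def)
  have 5: "vreach (8, ctr k 0 m i 0 m 0 0) (49, ctr k 0 m i 0 0 0 0)"
    using cm_clear[of "verifier v" 8 1 7 9 49 "ctr k 0 m i 0 m 0 0" z] by (simp add: verifier_def)
  have 6: "vreach (10, ctr k n m i n m 0 0) (47, ctr k n m i 0 0 0 (of_bool (cmp False m n)))"
    using vcompare[of k n m i n m False] by simp
  have 7: "vreach (47, ctr k n m i 0 0 0 (of_bool (cmp False m n)))
      (if cmp False m n then 48 else 52, ctr k n m i 0 0 0 (of_bool (cmp False m n)))"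
    by (rule vstep[where i = "Lt 1 9 48 52"]) (simp_all add: verifier_def)
  have 8: "vreach (48, ctr k n m i 0 0 0 1) (49, ctr k n m i 0 0 0 0)"
    by (rule vstep[where i = "Dec 9 49"]) (simp_all add: verifier_def)
  have cmp: "cmp False m n \<longleftrightarrow> olt (ord_of m) (ord_of n)"
    using olt_irrefl by (auto simp: cmp_eq)
  consider "m = 0" | "m \<noteq> 0" "n = 0" | "m \<noteq> 0" "n \<noteq> 0" "cmp False m n" | "m \<noteq> 0" "n \<noteq> 0" "\<not> cmp False m n"
    by blast
  then show ?thesis
  proof cases
    case 1
    then show ?thesis using vtrans[OF \<open>vreach (2, _) _\<close> 2] by (simp add: below_def)
  next
    case 2
    then have "vreach (2, ctr k n m i 0 0 0 0) (8, ctr k n m i n m 0 0)"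
      using vtrans[OF 1 vtrans[OF \<open>vreach (4, _) _\<close>, of "(8, ctr k n m i n m 0 0)"]] vtrans[OF 3 4] by simp
    then show ?thesis using 2 vtrans[OF _ 5] by (simp add: below_def)
  next
    case 3
    then have "vreach (2, ctr k n m i 0 0 0 0) (10, ctr k n m i n m 0 0)"
      using vtrans[OF 1 vtrans[OF 2, of "(10, ctr k n m i n m 0 0)"]] vtrans[OF \<open>vreach (5, _) _\<close> 4] by simp
    moreover have "vreach (10, ctr k n m i n m 0 0) (48, ctr k n m i 0 0 0 1)"
      using vtrans[OF 6 7] 3 by simp
    ultimately show ?thesis using 3 vtrans[OF _ vtrans[OF _ 8]] cmp by (simp add: below_def)
  next
    case 4
    then have "vreach (2, ctr k n m i 0 0 0 0) (10, ctr k n m i n m 0 0)"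
      using vtrans[OF 1 vtrans[OF 2, of "(10, ctr k n m i n m 0 0)"]] vtrans[OF 3 \<open>vreach (7, _) _\<close>] by simp
    moreover have "vreach (10, ctr k n m i n m 0 0) (52, ctr k n m i 0 0 0 0)"
      using vtrans[OF 6 7] 4 by simp
    ultimately show ?thesis using 4 vtrans cmp by (simp add: below_def)
  qed
qed

text \<open>The code \<open>i\<close> is a separate argument because the machine keeps it in a
  counter of its own instead of computing it from \<open>m\<close> and \<open>n\<close>.\<close>

definition active :: "nat \<Rightarrow> nat \<Rightarrow> nat \<Rightarrow> bool" where
  "active m n i \<longleftrightarrow> below m n \<and> z (10 * i) \<and> z (10 * m + 1)"

lemma vactive:
  "vreach (2, ctr k n m i 0 0 0 0) (if active m n i then 51 else 52, ctr k n m i 0 0 0 0)"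
proof -
  have 1: "vreach (49, ctr k n m i 0 0 0 0) (if z (10 * i) then 50 else 52, ctr k n m i 0 0 0 0)"
    by (rule vstep[where i = "In 5 0 50 52"]) (simp_all add: verifier_def)
  have 2: "vreach (50, ctr k n m i 0 0 0 0) (if z (10 * m + 1) then 51 else 52, ctr k n m i 0 0 0 0)"
    by (rule vstep[where i = "In 4 1 51 52"]) (simp_all add: verifier_def)
  have 3: "vreach (49, ctr k n m i 0 0 0 0)
      (if z (10 * i) \<and> z (10 * m + 1) then 51 else 52, ctr k n m i 0 0 0 0)"
    using 1 2 vtrans[OF 1] by (cases "z (10 * i)") auto
  have 4: "vreach (2, ctr k n m i 0 0 0 0) (if below m n then 49 else 52, ctr k n m i 0 0 0 0)"
    by (rule vbelow)
  show ?thesis using 3 4 vtrans[OF 4] unfolding active_def by (cases "below m n") auto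
qed

text \<open>An active input refutes a true guess and certifies a false one. A true guess is accepted
  provisionally: if it is wrong, a later pair refutes it.\<close>

lemma vcertify:
  "\<exists>c. vreach (2, ctr k n m i 0 0 0 0)
     (if active m n i \<and> z (10 * n + 1) then (46, c)
      else if (active m n i \<or> z (10 * n + 1)) \<and> n = k then (55, ctr k n m i 0 0 0 0)
      else (60, ctr k n m i 0 0 0 0))"
proof -
  have 1: "vreach (51, ctr k n m i 0 0 0 0) (if z (10 * n + 1) then 46 else 53, ctr k n m i 0 0 0 0)"
    by (rule vstep[where i = "In 3 1 46 53"]) (simp_all add: verifier_def)
  have 2: "vreach (52, ctr k n m i 0 0 0 0) (if z (10 * n + 1) then 53 else 60, ctr k n m i 0 0 0 0)"
    by (rule vstep[where i = "In 3 1 53 60"]) (simp_all add: verifier_def)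
  have 3: "vreach (53, ctr k n m i 0 0 0 0) (if n < k then 60 else 54, ctr k n m i 0 0 0 0)"
    by (rule vstep[where i = "Lt 3 2 60 54"]) (simp_all add: verifier_def)
  have 4: "vreach (54, ctr k n m i 0 0 0 0) (if k < n then 60 else 55, ctr k n m i 0 0 0 0)"
    by (rule vstep[where i = "Lt 2 3 60 55"]) (simp_all add: verifier_def)
  have 5: "vreach (53, ctr k n m i 0 0 0 0) (if n = k then 55 else 60, ctr k n m i 0 0 0 0)"
    using 3 vtrans[OF 3] 4 by (cases n k rule: linorder_cases) auto
  have act: "vreach (2, ctr k n m i 0 0 0 0) (if active m n i then 51 else 52, ctr k n m i 0 0 0 0)"
    by (rule vactive)
  consider "active m n i" "z (10 * n + 1)" | "active m n i" "\<not> z (10 * n + 1)"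
    | "\<not> active m n i" "z (10 * n + 1)" | "\<not> active m n i" "\<not> z (10 * n + 1)" by blast
  then show ?thesis
  proof cases
    case 1
    then show ?thesis using vtrans[OF act] \<open>vreach (51, _) _\<close> by auto
  next
    case 2
    then have "vreach (2, ctr k n m i 0 0 0 0) (53, ctr k n m i 0 0 0 0)"
      using vtrans[OF act, of "(53, ctr k n m i 0 0 0 0)"] 1 by simp
    then show ?thesis using vtrans[OF _ 5] 2 by auto
  next
    case 3
    then have "vreach (2, ctr k n m i 0 0 0 0) (53, ctr k n m i 0 0 0 0)"
      using vtrans[OF act, of "(53, ctr k n m i 0 0 0 0)"] 2 by simp
    then show ?thesis using vtrans[OF _ 5] 3 by auto
  next
    case 4
    then show ?thesis using vtrans[OF act] 2 by auto
  qed
qed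

definition rejected :: "nat \<Rightarrow> nat \<Rightarrow> nat \<Rightarrow> bool" where
  "rejected m n i \<longleftrightarrow> n = 0 \<and> z 1 \<noteq> v \<or> active m n i \<and> z (10 * n + 1)"

lemma vround:
  "\<exists>c. vreach (0, ctr k n m i 0 0 0 0)
     (if rejected m n i then (46, c)
      else if (active m n i \<or> z (10 * n + 1)) \<and> n = k then (55, ctr k n m i 0 0 0 0)
      else (60, ctr k n m i 0 0 0 0))"
proof -
  have 1: "vreach (0, ctr k n m i 0 0 0 0) (if n = 0 then 1 else 2, ctr k n m i 0 0 0 0)"
    by (rule vstep[where i = "Lt 1 3 2 1"]) (simp_all add: verifier_def)
  have 2: "vreach (1, ctr k n m i 0 0 0 0) (if z (10 * n + 1) = v then 2 else 46, ctr k n m i 0 0 0 0)"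
    by (rule vstep[where i = "In 3 1 (if v then 2 else 46) (if v then 46 else 2)"])
       (simp_all add: verifier_def)
  show ?thesis
  proof (cases "n = 0 \<and> z 1 \<noteq> v")
    case True
    then have "vreach (0, ctr k n m i 0 0 0 0) (46, ctr k n m i 0 0 0 0)"
      using vtrans[OF 1, of "(46, ctr k n m i 0 0 0 0)"] 2 by simp
    then show ?thesis using True by (auto simp: rejected_def)
  next
    case False
    then have "vreach (0, ctr k n m i 0 0 0 0) (2, ctr k n m i 0 0 0 0)"
      using 1 vtrans[OF 1, of "(2, ctr k n m i 0 0 0 0)"] 2 by (cases "n = 0") auto
    note pre = vtrans[OF this]
    have "rejected m n i \<longleftrightarrow> active m n i \<and> z (10 * n + 1)" using False by (auto simp: rejected_def)
    then show ?thesis using vcertify[of k n m i] pre by (simp only:) blast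
  qed
qed

text \<open>The pairing function runs through the diagonals: (m, n + 1) is followed by (m + 1, n),
  and at the end of a diagonal (m, 0) is followed by (0, m + 1).\<close>

lemma vnext:
  assumes "prod_decode i = (m, n)" "prod_decode (Suc i) = (m', n')"
  shows "vreach (60, ctr k n m i 0 0 0 0) (0, ctr k n' m' (Suc i) 0 0 0 0)"
proof -
  have i: "i = prod_encode (m, n)" using assms(1) by (metis prod_decode_inverse)
  have 1: "vreach (60, ctr k n m i 0 0 0 0) (61, ctr k n m (Suc i) 0 0 0 0)"
    by (rule vstep[where i = "Inc 5 61"]) (simp_all add: verifier_def)
  have 2: "vreach (61, ctr k n m (Suc i) 0 0 0 0) (if n = 0 then 64 else 62, ctr k n m (Suc i) 0 0 0 0)"
    by (rule vstep[where i = "Lt 1 3 62 64"]) (simp_all add: verifier_def)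
  show ?thesis
  proof (cases n)
    case 0
    have 3: "vreach (64, ctr k 0 m (Suc i) 0 0 0 0) (65, ctr k 1 m (Suc i) 0 0 0 0)"
      by (rule vstep[where i = "Inc 3 65"]) (simp_all add: verifier_def)
    have 4: "vreach (65, ctr k 1 m (Suc i) 0 0 0 0) (0, ctr k (Suc m) 0 (Suc i) 0 0 0 0)"
      using cm_move[of "verifier v" 65 1 4 69 0 70 3 "ctr k 1 m (Suc i) 0 0 0 0" z]
      by (simp add: verifier_def)
    have "Suc i = prod_encode (0, Suc m)" using 0 i by (simp add: prod_encode_def)
    then have "m' = 0" "n' = Suc m" using assms(2) by simp_all
    then show ?thesis using vtrans[OF 1, of "(64, ctr k n m (Suc i) 0 0 0 0)"] 2 vtrans[OF _ vtrans[OF 3 4]] 0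
      by simp
  next
    case (Suc n0)
    have 3: "vreach (62, ctr k n m (Suc i) 0 0 0 0) (63, ctr k n0 m (Suc i) 0 0 0 0)"
      by (rule vstep[where i = "Dec 3 63"]) (simp_all add: verifier_def Suc)
    have 4: "vreach (63, ctr k n0 m (Suc i) 0 0 0 0) (0, ctr k n0 (Suc m) (Suc i) 0 0 0 0)"
      by (rule vstep[where i = "Inc 4 0"]) (simp_all add: verifier_def)
    have "Suc i = prod_encode (Suc m, n0)" using Suc i by (simp add: prod_encode_def)
    then have "m' = Suc m" "n' = n0" using assms(2) by simp_all
    then show ?thesis using vtrans[OF 1, of "(62, ctr k n m (Suc i) 0 0 0 0)"] 2 vtrans[OF _ vtrans[OF 3 4]] Suc
      by simp
  qed
qed

lemma vrestart: "vreach (56, ctr k n m i 0 0 0 0) (0, ctr (Suc k) 0 0 0 0 0 0 0)"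
proof -
  have 1: "vreach (56, ctr k n m i 0 0 0 0) (57, ctr (Suc k) n m i 0 0 0 0)"
    by (rule vstep[where i = "Inc 2 57"]) (simp_all add: verifier_def)
  have 2: "vreach (57, ctr (Suc k) n m i 0 0 0 0) (59, ctr (Suc k) 0 m i 0 0 0 0)"
    using cm_clear[of "verifier v" 57 1 3 58 59 "ctr (Suc k) n m i 0 0 0 0" z] by (simp add: verifier_def)
  have 3: "vreach (59, ctr (Suc k) 0 m i 0 0 0 0) (67, ctr (Suc k) 0 0 i 0 0 0 0)"
    using cm_clear[of "verifier v" 59 1 4 66 67 "ctr (Suc k) 0 m i 0 0 0 0" z] by (simp add: verifier_def)
  have 4: "vreach (67, ctr (Suc k) 0 0 i 0 0 0 0) (0, ctr (Suc k) 0 0 0 0 0 0 0)"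
    using cm_clear[of "verifier v" 67 1 5 68 0 "ctr (Suc k) 0 0 i 0 0 0 0" z] by (simp add: verifier_def)
  show ?thesis by (rule vtrans[OF 1 vtrans[OF 2 vtrans[OF 3 4]]])
qed

end

section \<open>The search behind the verifier\<close>

fun astep :: "bool \<Rightarrow> real2 \<Rightarrow> (nat \<times> nat) option \<Rightarrow> (nat \<times> nat) option" where
  "astep v z None = None"
| "astep v z (Some (k, i)) = (case prod_decode i of (m, n) \<Rightarrow>
     if rejected v z m n i then None
     else if (active z m n i \<or> z (10 * n + 1)) \<and> n = k then Some (Suc k, 0)
     else Some (k, Suc i))"

fun aflash :: "bool \<Rightarrow> real2 \<Rightarrow> (nat \<times> nat) option \<Rightarrow> bool" where
  "aflash v z None \<longleftrightarrow> False"
| "aflash v z (Some (k, i)) \<longleftrightarrow> (case prod_decode i of (m, n) \<Rightarrow>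
     \<not> rejected v z m n i \<and> (active z m n i \<or> z (10 * n + 1)) \<and> n = k)"

text \<open>Instruction 46 is \<open>Halt\<close>, where a refuted guess ends. A living search is
  compared with the program only at the top of its loop, where the working counters are 0.\<close>

fun vsim :: "cmstate \<Rightarrow> (nat \<times> nat) option \<Rightarrow> bool" where
  "vsim s None \<longleftrightarrow> fst s = 46"
| "vsim s (Some (k, i)) \<longleftrightarrow>
     s = (0, ctr k (snd (prod_decode i)) (fst (prod_decode i)) i 0 0 0 0)"

lemma vsim_step:
  assumes "vsim s a"
  shows "\<exists>t>0. vsim ((cmstep (verifier v) z ^^ t) s) (astep v z a) \<and>
    ((\<exists>i<t. at_flash (verifier v) ((cmstep (verifier v) z ^^ i) s)) \<longleftrightarrow> aflash v z a)"
proof (cases a)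
  case None
  then have "verifier v ! fst s = Halt" "fst s = 46" using assms by (simp_all add: verifier_def)
  then have "cmstep (verifier v) z s = s" "\<not> at_flash (verifier v) s"
    by (cases s; simp add: cmstep_def at_flash_def)+
  then show ?thesis using None assms by (intro exI[of _ 1]) auto
next
  case (Some ki)
  obtain k i where ki: "ki = (k, i)" by (cases ki)
  obtain m n where mn: "prod_decode i = (m, n)" by (cases "prod_decode i")
  let ?f = "cmstep (verifier v) z" and ?F = "at_flash (verifier v)"
  have s: "s = (0, ctr k n m i 0 0 0 0)" using assms Some ki mn by simp
  obtain c where c: "vreach v z s
     (if rejected v z m n i then (46, c)
      else if (active z m n i \<or> z (10 * n + 1)) \<and> n = k then (55, ctr k n m i 0 0 0 0)
      else (60, ctr k n m i 0 0 0 0))"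
    using vround[of v z k n m i] s by blast
  consider (rej) "rejected v z m n i"
    | (flash) "\<not> rejected v z m n i" "(active z m n i \<or> z (10 * n + 1)) \<and> n = k"
    | (cont) "\<not> rejected v z m n i" "\<not> ((active z m n i \<or> z (10 * n + 1)) \<and> n = k)" by blast
  then show ?thesis
  proof cases
    case rej
    then obtain t where t: "(?f ^^ t) s = (46, c)" "\<forall>i<t. \<not> ?F ((?f ^^ i) s)"
      using quiet_steps_funpow[of ?f ?F s "(46, c)"] c by auto
    then have "t > 0" using s by (cases t) auto
    then show ?thesis using t rej Some ki mn by auto
  next
    case flash
    let ?s1 = "(55, ctr k n m i 0 0 0 0)"
    obtain t where t: "(?f ^^ t) s = ?s1" "\<forall>i<t. \<not> ?F ((?f ^^ i) s)"
      using quiet_steps_funpow[of ?f ?F s ?s1] c flash by auto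
    have F: "?F ?s1" "?f ?s1 = (56, ctr k n m i 0 0 0 0)"
      by (simp_all add: at_flash_def cmstep_def verifier_def)
    obtain t' where t': "(?f ^^ t') (56, ctr k n m i 0 0 0 0) = (0, ctr (Suc k) 0 0 0 0 0 0 0)"
      using quiet_steps_funpow[OF vrestart[of v z k n m i]] by auto
    have "(?f ^^ (t' + Suc t)) s = (0, ctr (Suc k) 0 0 0 0 0 0 0)"
      using t F t' by (simp only: funpow_add comp_apply funpow.simps)
    moreover have "\<exists>i<t' + Suc t. ?F ((?f ^^ i) s)"
      using t F by (intro exI[of _ t]) auto
    moreover have "prod_decode 0 = (0, 0)" by (simp add: prod_decode_def prod_decode_aux.simps)
    ultimately show ?thesis using flash Some ki mn by (intro exI[of _ "t' + Suc t"]) auto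
  next
    case cont
    obtain m' n' where mn': "prod_decode (Suc i) = (m', n')" by (cases "prod_decode (Suc i)")
    have "vreach v z s (0, ctr k n' m' (Suc i) 0 0 0 0)"
      using rtranclp_trans[OF c] vnext[OF mn mn', of v z k] cont by auto
    then obtain t where t: "(?f ^^ t) s = (0, ctr k n' m' (Suc i) 0 0 0 0)" "\<forall>i<t. \<not> ?F ((?f ^^ i) s)"
      using quiet_steps_funpow by metis
    have "ctr k n m i 0 0 0 0 \<noteq> ctr k n' m' (Suc i) 0 0 0 0"
      by (metis ctr_simps(5) n_not_Suc_n)
    then have "t > 0" using s t by (cases t) auto
    then show ?thesis using t cont Some ki mn mn' by (intro exI[of _ t]) auto
  qed
qed

definition certificate :: "bool \<Rightarrow> real2 \<Rightarrow> bool" where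
  "certificate v z \<longleftrightarrow> z 1 = v \<and>
     (\<forall>n. z (10 * n + 1) \<longleftrightarrow> \<not> (\<exists>m. active z m n (prod_encode (m, n))))"

lemma astep_search:
  assumes "\<And>j. j < i \<Longrightarrow> \<not> aflash v z (Some (k, j))"
    and "\<And>j m n. prod_decode j = (m, n) \<Longrightarrow> \<not> rejected v z m n j"
  shows "(astep v z ^^ i) (Some (k, 0)) = Some (k, i)"
  using assms(1)
proof (induction i)
  case 0
  then show ?case by simp
next
  case (Suc i)
  obtain m n where mn: "prod_decode i = (m, n)" by (cases "prod_decode i")
  have "\<not> aflash v z (Some (k, i))" using Suc.prems by blast
  then show ?case using Suc mn assms(2)[OF mn] by auto
qed

text \<open>A correct guess is never refuted, and for each gate some pair certifies it: any pair if
  the gate is true, a pair with an active input if it is false. So every search ends with a success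
  and the next one begins.\<close>

lemma recurs_if_certificate:
  assumes "certificate v z"
  shows "recurs (astep v z) (aflash v z) (Some (0, 0))"
proof -
  have rej: "\<not> rejected v z m n i" if "prod_decode i = (m, n)" for i m n
  proof -
    have "i = prod_encode (m, n)" using that by (metis prod_decode_inverse)
    then show ?thesis using assms unfolding certificate_def rejected_def by auto
  qed
  have flash: "\<exists>i. (astep v z ^^ i) (Some (k, 0)) = Some (k, i) \<and> aflash v z (Some (k, i))" for k
  proof -
    obtain m where "active z m k (prod_encode (m, k)) \<or> z (10 * k + 1)"
      using assms unfolding certificate_def by blast
    then have "aflash v z (Some (k, prod_encode (m, k)))" using rej by simp
    then obtain i where i: "aflash v z (Some (k, i))" "\<And>j. j < i \<Longrightarrow> \<not> aflash v z (Some (k, j))"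
      using exists_least_iff[of "\<lambda>i. aflash v z (Some (k, i))"] by blast
    then show ?thesis using astep_search[OF i(2) rej] by blast
  qed
  have start: "\<exists>t. (astep v z ^^ t) (Some (0, 0)) = Some (k, 0)" for k
  proof (induction k)
    case 0
    then show ?case by (auto intro: exI[of _ 0])
  next
    case (Suc k)
    then obtain t where t: "(astep v z ^^ t) (Some (0, 0)) = Some (k, 0)" by blast
    obtain i where i: "(astep v z ^^ i) (Some (k, 0)) = Some (k, i)" "aflash v z (Some (k, i))"
      using flash by blast
    then have "astep v z (Some (k, i)) = Some (Suc k, 0)" by (auto split: prod.splits)
    then have "(astep v z ^^ (Suc i + t)) (Some (0, 0)) = Some (Suc k, 0)"
      using i t by (simp only: funpow_add comp_apply funpow.simps)
    then show ?case by blast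
  qed
  \<comment> \<open>The successes are mapped to the gates that they certify. Every gate is reached,
    so there are infinitely many successes.\<close>
  let ?I = "{t. aflash v z ((astep v z ^^ t) (Some (0, 0)))}"
  have "k \<in> (\<lambda>t. fst (the ((astep v z ^^ t) (Some (0, 0))))) ` ?I" for k
  proof -
    obtain t where t: "(astep v z ^^ t) (Some (0, 0)) = Some (k, 0)" using start by blast
    obtain i where i: "(astep v z ^^ i) (Some (k, 0)) = Some (k, i)" "aflash v z (Some (k, i))"
      using flash by blast
    then have "(astep v z ^^ (i + t)) (Some (0, 0)) = Some (k, i)" using t by (simp add: funpow_add)
    then show ?thesis using i(2) by (intro image_eqI[of _ _ "i + t"]) auto
  qed
  then have "(\<lambda>t. fst (the ((astep v z ^^ t) (Some (0, 0))))) ` ?I = UNIV" by blast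
  then have "infinite ?I" by (metis finite_imageI infinite_UNIV_nat)
  then show ?thesis by (simp add: recurs_def INFM_iff_infinite)
qed

text \<open>Infinitely many successes drive \<open>k\<close> beyond every gate. The certificates
  found show that a false gate has an active input, and the absence of refutations shows that a true
  gate has none.\<close>

lemma certificate_if_recurs:
  assumes "recurs (astep v z) (aflash v z) (Some (0, 0))"
  shows "certificate v z"
proof -
  let ?o = "\<lambda>t. (astep v z ^^ t) (Some (0, 0))"
  let ?rej = "\<lambda>i. case prod_decode i of (m, n) \<Rightarrow> rejected v z m n i"
  have orbit: "(\<forall>j<i. \<not> ?rej j) \<and>
      (\<forall>l<k. \<exists>m. (active z m l (prod_encode (m, l)) \<or> z (10 * l + 1)) \<and>
        (\<forall>j\<le>prod_encode (m, l). \<not> ?rej j))"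
    if "?o t = Some (k, i)" for t k i
    using that
  proof (induction t arbitrary: k i)
    case 0
    then show ?case by simp
  next
    case (Suc t)
    then obtain k0 i0 where 0: "?o t = Some (k0, i0)" by (cases "?o t") auto
    obtain m n where mn: "prod_decode i0 = (m, n)" by (cases "prod_decode i0")
    then have i0: "i0 = prod_encode (m, n)" by (metis prod_decode_inverse)
    have step: "astep v z (Some (k0, i0)) = Some (k, i)" using Suc.prems 0 by simp
    note IH = Suc.IH[OF 0]
    have nrej: "\<not> rejected v z m n i0" using step mn by auto
    then have nrej': "\<forall>j\<le>i0. \<not> ?rej j" using IH mn by (auto simp: le_less)
    show ?case
    proof (cases "(active z m n i0 \<or> z (10 * n + 1)) \<and> n = k0")
      case True
      then have "k = Suc k0" "i = 0" using step mn nrej by auto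
      then show ?thesis using IH True nrej' i0 by (auto simp: less_Suc_eq)
    next
      case False
      then have "k = k0" "i = Suc i0" using step mn nrej by auto
      then show ?thesis using IH nrej' by (auto simp: less_Suc_eq_le)
    qed
  qed
  have alive: "\<exists>k i. ?o t = Some (k, i)" for t
  proof (rule ccontr)
    assume "\<not> ?thesis"
    then have "?o t = None" by (cases "?o t") auto
    then have "?o (t + u) = None" for u by (induction u) auto
    moreover obtain u where "u \<ge> t" "aflash v z (?o u)"
      using assms unfolding recurs_def INFM_nat_le by blast
    ultimately show False by (metis aflash.simps(1) le_add_diff_inverse)
  qed
  have mono: "\<exists>k' i'. ?o (t + u) = Some (k', i') \<and> k \<le> k'" if "?o t = Some (k, i)" for t u k i
  proof (induction u)
    case 0
    then show ?case using that by simp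
  next
    case (Suc u)
    then obtain k' i' where "?o (t + u) = Some (k', i')" "k \<le> k'" by blast
    moreover obtain k'' i'' where "?o (t + Suc u) = Some (k'', i'')" using alive by blast
    ultimately show ?case by (auto split: prod.splits if_splits)
  qed
  have unbounded: "\<exists>t k i. ?o t = Some (k, i) \<and> l \<le> k" for l
  proof (induction l)
    case 0
    then show ?case using alive[of 0] by blast
  next
    case (Suc l)
    then obtain t k i where t: "?o t = Some (k, i)" "l \<le> k" by blast
    obtain u where u: "u \<ge> t" "aflash v z (?o u)"
      using assms unfolding recurs_def INFM_nat_le by blast
    obtain k' i' where k': "?o u = Some (k', i')" "k \<le> k'"
      using mono[OF t(1), of "u - t"] u(1) by auto
    then have "?o (Suc u) = Some (Suc k', 0)" using u(2) by (auto split: prod.splits)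
    then show ?case using k' t(2) by (meson Suc_le_mono le_trans)
  qed
  have cert: "\<exists>m. (active z m l (prod_encode (m, l)) \<or> z (10 * l + 1)) \<and>
        (\<forall>j\<le>prod_encode (m, l). \<not> ?rej j)" for l
    using unbounded[of "Suc l"] orbit by (meson Suc_le_lessD)
  have "\<not> ?rej i" for i
  proof -
    \<comment> \<open>The success for gate \<open>i\<close> comes at a code that is at least
      \<open>i\<close>, after all smaller codes have been inspected. Hence no code at all is
      refuting.\<close>
    obtain m where "\<forall>j\<le>prod_encode (m, i). \<not> ?rej j" using cert[of i] by blast
    then show ?thesis using le_prod_encode_2[of i m] by simp
  qed
  then have nrej: "\<not> rejected v z m n (prod_encode (m, n))" for m n
    by (metis (no_types, lifting) case_prod_conv prod_encode_inverse)
  have "z 1 = v" using nrej[of 0 0] by (auto simp: rejected_def)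
  moreover have "z (10 * n + 1) \<longleftrightarrow> \<not> (\<exists>m. active z m n (prod_encode (m, n)))" for n
    using cert[of n] nrej by (auto simp: rejected_def)
  ultimately show ?thesis by (simp add: certificate_def)
qed

theorem accepts_verifier: "accepts (tm (verifier v)) z \<longleftrightarrow> certificate v z"
proof -
  have "prod_decode 0 = (0, 0)" by (simp add: prod_decode_def prod_decode_aux.simps)
  moreover have "(\<lambda>_. 0) = ctr 0 0 0 0 0 0 0 0" by (auto simp: ctr_def)
  ultimately have "vsim (0, \<lambda>_. 0) (Some (0, 0))" by simp
  then have "recurs (cmstep (verifier v) z) (at_flash (verifier v)) (0, \<lambda>_. 0) \<longleftrightarrow>
      recurs (astep v z) (aflash v z) (Some (0, 0))"
    by (rule recurs_simulation) (rule vsim_step)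
  then show ?thesis
    using tm_correct(2)[OF ok_verifier] recurs_if_certificate certificate_if_recurs by blast
qed

section \<open>Circuits of NOR gates\<close>

lemma wf_below: "wf {(m, n). below m n}"
  unfolding wf_eq_minimal
proof (intro allI impI)
  fix Q :: "nat set" and a assume "a \<in> Q"
  show "\<exists>n\<in>Q. \<forall>m. (m, n) \<in> {(m, n). below m n} \<longrightarrow> m \<notin> Q"
  proof (cases "Q - {0} = {}")
    case True
    then show ?thesis using \<open>a \<in> Q\<close> by (auto simp: below_def)
  next
    case False
    then obtain b where "ord_of b \<in> ord_of ` (Q - {0})" by blast
    from olt_minimal[OF this isord_ord_of]
    obtain n where "n \<in> Q - {0}" "\<forall>h. olt h (ord_of n) \<longrightarrow> h \<notin> ord_of ` (Q - {0})"
      by (elim bexE imageE) simp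
    then show ?thesis by (intro bexI[of _ n]) (auto simp: below_def)
  qed
qed

context
  notes conj_cong [fundef_cong]
begin

text \<open>Wires that do not go upwards are ignored, so every real is a circuit. The congruence
  rule for conjunctions supplies \<open>below m n\<close> to the termination proof.\<close>

function gate :: "real2 \<Rightarrow> nat \<Rightarrow> bool" where
  "gate x n = (\<not> (\<exists>m. below m n \<and> x (5 * prod_encode (m, n)) \<and> gate x m))"
  by auto
termination
  by (relation "inv_image {(m, n). below m n} snd") (auto intro: wf_below)

end

declare gate.simps [simp del]

lemma gate_unique:
  assumes "\<And>n. E n = (\<not> (\<exists>m. below m n \<and> x (5 * prod_encode (m, n)) \<and> E m))"
  shows "E n = gate x n"
proof (induction n rule: wf_induct[OF wf_below])
  case (1 n)
  then show ?case using assms[of n] by (subst gate.simps) auto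
qed

text \<open>The local conditions on a guess have exactly one solution on the positions that are
  read, namely the true gate values. Hence the guess leaves no freedom at the root.\<close>

lemma certificate_gate:
  "(\<exists>y. certificate v (pair_real x y)) \<longleftrightarrow> gate x 0 = v"
proof
  have pair: "pair_real x y (10 * n + 1) = y (5 * n)" "pair_real x y (10 * n) = x (5 * n)"
    "pair_real x y 1 = y 0" for y n
    by (simp_all add: pair_real_def)
  show "\<exists>y. certificate v (pair_real x y) \<Longrightarrow> gate x 0 = v"
  proof -
    assume "\<exists>y. certificate v (pair_real x y)"
    then obtain y where y: "certificate v (pair_real x y)" ..
    have "y (5 * n) = gate x n" for n
      by (rule gate_unique[where E = "\<lambda>n. y (5 * n)"])
         (use y in \<open>unfold certificate_def active_def pair, blast\<close>)
    from this[of 0] show ?thesis using y unfolding certificate_def pair by simp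
  qed
  show "\<exists>y. certificate v (pair_real x y)" if "gate x 0 = v"
  proof
    show "certificate v (pair_real x (\<lambda>i. gate x (i div 5)))"
      unfolding certificate_def active_def pair
    proof (intro conjI allI)
      fix n
      show "gate x (5 * n div 5) = (\<not> (\<exists>m. below m n \<and> x (5 * prod_encode (m, n)) \<and> gate x (5 * m div 5)))"
        by (simp add: gate.simps[of x n])
    qed (use that in simp)
  qed
qed

section \<open>Runs as circuits\<close>

text \<open>The ordinal omega^2 * \<alpha> + omega * l + c. Stage and level dominate
  \<open>c\<close>, so that a gate may depend on infinitely many gates of a lower level of its own
  stage.\<close>

definition node :: "ordw \<Rightarrow> nat \<Rightarrow> nat \<Rightarrow> ordw" where
  "node \<alpha> l c = (oshift (oshift \<alpha>))(1 := l, 0 := c)"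

lemma node_simps [simp]: "node \<alpha> l c 0 = c" "node \<alpha> l c (Suc 0) = l" "node \<alpha> l c (Suc (Suc i)) = \<alpha> i"
  "isord (node \<alpha> l c) = isord \<alpha>"
  by (simp_all add: node_def)

lemma node_neq_ozero: "l \<noteq> 0 \<Longrightarrow> node \<alpha> l c \<noteq> ozero"
  by (metis node_simps(2) ozero_app)

lemma node_ozero: "node ozero 0 0 = ozero"
  unfolding node_def oshift_ozero by (auto simp: ozero_def)

lemma olt_node:
  assumes "olt \<alpha> \<beta> \<or> \<alpha> = \<beta> \<and> l < l'"
  shows "olt (node \<alpha> l c) (node \<beta> l' c')"
  using assms
proof
  assume "olt \<alpha> \<beta>"
  then obtain i where i: "\<alpha> i < \<beta> i" "\<forall>j>i. \<alpha> j = \<beta> j" by (auto simp: olt_def)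
  have "node \<alpha> l c j = node \<beta> l' c' j" if "j > Suc (Suc i)" for j
  proof -
    obtain j' where "j = Suc (Suc j')" using \<open>j > Suc (Suc i)\<close> by (metis Suc_lessE)
    then show ?thesis using i(2) that by simp
  qed
  then show ?thesis unfolding olt_def using i(1) by (intro exI[of _ "Suc (Suc i)"]) simp
next
  assume a: "\<alpha> = \<beta> \<and> l < l'"
  have "node \<alpha> l c j = node \<beta> l' c' j" if "j > Suc 0" for j
  proof -
    have "j = Suc (Suc (j - 2))" using that by simp
    then obtain j' where "j = Suc (Suc j')" ..
    then show ?thesis using a by simp
  qed
  then show ?thesis unfolding olt_def using a by (intro exI[of _ "Suc 0"]) simp
qed

lemma olt_ozero_olimit: "olimit \<alpha> \<Longrightarrow> olt ozero \<alpha>"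
  using olt_linear[of ozero \<alpha>] by (auto simp: olimit_def)

text \<open>An item is an atomic statement about a configuration: the state, the head position or
  one cell. There are countably many items, so each stage has room for a gate per item.\<close>

definition cval :: "config \<Rightarrow> nat \<times> nat \<Rightarrow> bool" where
  "cval c it = (case it of (t, j) \<Rightarrow> if t = 0 then cstate c = j else if t = 1 then chead c = j
     else if t = 2 then ctape1 c j else if t = 3 then ctape2 c j else ctape3 c j)"

type_synonym view = "nat \<times> nat \<times> bool \<times> bool \<times> bool \<times> bool"

text \<open>The finite information that determines an item after one step. The old value of the item
  is included for cells that are not scanned.\<close>

definition view :: "config \<Rightarrow> nat \<times> nat \<Rightarrow> view" where
  "view c it = (cstate c, chead c, ctape1 c (chead c), ctape2 c (chead c), ctape3 c (chead c), cval c it)"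

definition outcome :: "program \<Rightarrow> nat \<times> nat \<Rightarrow> view \<Rightarrow> bool" where
  "outcome p it w = (case it of (t, j) \<Rightarrow> case w of (q, h, a, b, e, u) \<Rightarrow>
     case snd p q a b e of (q', w1, w2, w3, mv) \<Rightarrow>
       if t = 0 then q' = j else if t = 1 then (if mv then Suc h else h - 1) = j
       else if j = h then (if t = 2 then w1 else if t = 3 then w2 else w3) else u)"

lemma cval_step: "cval (step p c) it = outcome p it (view c it)"
proof -
  obtain q h t1 t2 t3 where c: "c = (q, h, t1, t2, t3)" by (metis prod_cases5)
  obtain q' w1 w2 w3 mv where d: "snd p q (t1 h) (t2 h) (t3 h) = (q', w1, w2, w3, mv)" by (metis prod_cases5)
  show ?thesis unfolding c
    by (cases it) (auto simp: d cval_def outcome_def view_def step_def cstate_def chead_def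
        ctape1_def ctape2_def ctape3_def Let_def)
qed

definition literals :: "nat \<times> nat \<Rightarrow> view \<Rightarrow> ((nat \<times> nat) \<times> bool) set" where
  "literals it w = (case w of (q, h, a, b, e, u) \<Rightarrow>
     {((0, q), True), ((1, h), True), ((2, h), a), ((3, h), b), ((4, h), e), (it, u)})"

lemma literals_view: "(\<forall>(i, b)\<in>literals it w. cval c i = b) \<longleftrightarrow> w = view c it"
  by (cases w) (auto simp: literals_def view_def cval_def)

text \<open>Each stage of the run has gates on five levels: 3 for the items, 4 for their negations,
  2 for auxiliary gates (a possible view of the previous configuration, or the assertion that a cell
  is 0 from some earlier stage on), and 5 for accepting at this stage; level 1 only
  serves as the constant true at stage 0. The root, which is at the node 0, negates acceptance.\<close>

definition children :: "program \<Rightarrow> real2 \<Rightarrow> ordw \<Rightarrow> nat \<Rightarrow> nat \<Rightarrow> ordw set" where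
  "children p z \<alpha> l c =
    (if l = 0 then {node \<beta> 5 0 | \<beta>. isord \<beta>}
     else if l = 5 then {node \<alpha> 4 (prod_encode (0, q_halt)), node \<alpha> 4 (prod_encode (4, 0))} \<union>
       {node \<gamma> 3 (prod_encode (0, q_halt)) | \<gamma>. isord \<gamma> \<and> olt \<gamma> \<alpha>}
     else if l = 4 then {node \<alpha> 3 c}
     else if l = 3 then
       (if \<alpha> = ozero then (if cval (initial z) (prod_decode c) then {} else {node ozero 1 0})
        else if \<alpha> 0 \<noteq> 0 then {node \<alpha> 2 (to_nat (prod_decode c, w)) | w. \<not> outcome p (prod_decode c) w}
        else if fst (prod_decode c) < 2 then
          (if prod_decode c = (0, q_limit) \<or> prod_decode c = (1, 0) then {} else {node ozero 1 0})
        else {node \<alpha> 2 (to_nat (prod_decode c, b)) | b. olt (ord_of b) \<alpha>})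
     else if l = 2 then
       (if \<alpha> 0 \<noteq> 0 then (case from_nat c of (it, w) \<Rightarrow>
          {node (\<alpha>(0 := \<alpha> 0 - 1)) (if b then 4 else 3) (prod_encode i) | i b. (i, b) \<in> literals it w})
        else (case from_nat c of (it, b) \<Rightarrow>
          {node \<gamma> 3 (prod_encode it) | \<gamma>. isord \<gamma> \<and> \<not> olt \<gamma> (ord_of b) \<and> olt \<gamma> \<alpha>}))
     else {})"

text \<open>The description consults the input at gates of level 3 only, and for each of them in a
  single position. This locality makes self-reference possible.\<close>

lemma children_cong:
  assumes "l = 3 \<Longrightarrow> z (snd (prod_decode c)) = z' (snd (prod_decode c))"
  shows "children p z \<alpha> l c = children p z' \<alpha> l c"
proof -
  have "cval (initial z) (prod_decode c) = cval (initial z') (prod_decode c)" if "l = 3"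
    using assms[OF that]
    by (auto simp: cval_def initial_def cstate_def chead_def ctape1_def ctape2_def ctape3_def
        split: prod.splits)
  then show ?thesis unfolding children_def by simp
qed

definition child_of :: "program \<Rightarrow> real2 \<Rightarrow> nat \<Rightarrow> nat \<Rightarrow> bool" where
  "child_of p z m n \<longleftrightarrow>
     ord_of m \<in> children p z (\<lambda>i. ord_of n (Suc (Suc i))) (ord_of n 1) (ord_of n 0)"

text \<open>The circuit reads the input, which is its own description. This is not circular since an input
  bit only influences bits of the description at larger positions.\<close>

lemma self_reading_circuit: "\<exists>x. \<forall>m n. x (5 * prod_encode (m, n)) = child_of p x m n"
proof -
  define F where "F = (\<lambda>z i. \<exists>m n. i = 5 * prod_encode (m, n) \<and> child_of p z m n)"
  have F: "F z i = F z' i" if zz: "\<And>j. j < i \<Longrightarrow> z j = z' j" for z z' i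
  proof -
    have "child_of p z m n = child_of p z' m n" if i: "i = 5 * prod_encode (m, n)" for m n
    proof -
      have "z (snd (prod_decode (ord_of n 0))) = z' (snd (prod_decode (ord_of n 0)))" if "ord_of n 1 = 3"
      proof -
        \<comment> \<open>A gate of level 3 is not the root. So \<open>n\<close> is positive, and
          the factor 5 makes the position of each of its wires strictly larger than
          \<open>n\<close>.\<close>
        have "n \<noteq> 0" using that by (metis ord_of_0 ozero_app zero_neq_numeral)
        have "snd (prod_decode (ord_of n 0)) \<le> ord_of n 0"
          by (metis le_prod_encode_2 prod.collapse prod_decode_inverse)
        also have "\<dots> \<le> n" by (rule ord_of_finite_part_le)
        also have "n < i" using \<open>n \<noteq> 0\<close> le_prod_encode_2[of n m] i by linarith
        finally show ?thesis using zz by blast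
      qed
      then show ?thesis unfolding child_of_def using children_cong by metis
    qed
    then show ?thesis unfolding F_def by blast
  qed
  have "adm_wf less_than F" unfolding adm_wf_def by (intro allI impI F) simp
  then have x: "wfrec less_than F = F (wfrec less_than F)"
    by (rule wfrec_fixpoint[OF wf_less_than])
  have "wfrec less_than F (5 * prod_encode (m, n)) = child_of p (wfrec less_than F) m n" for m n
    by (subst x) (auto simp: F_def prod_encode_eq)
  then show ?thesis by blast
qed

lemma inv_ord_of [simp]: "inv ord_of (ord_of n) = n"
  by (rule inv_f_f) (simp add: inj_def)

lemma ord_of_inv [simp]: "isord f \<Longrightarrow> ord_of (inv ord_of f) = f"
  using ord_of_surj by (auto intro: f_inv_into_f)

context
  fixes p :: program and x :: real2
  assumes x: "\<And>m n. x (5 * prod_encode (m, n)) = child_of p x m n"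
begin

definition gate_at :: "ordw \<Rightarrow> nat \<Rightarrow> nat \<Rightarrow> bool" where
  "gate_at \<alpha> l c = gate x (inv ord_of (node \<alpha> l c))"

text \<open>The hypothesis says that all intended inputs lie below the gate, so that none of them is
  ignored by \<open>gate\<close>.\<close>

lemma gate_at_eq:
  assumes \<alpha>: "isord \<alpha>"
    and below: "\<And>g. g \<in> children p x \<alpha> l c \<Longrightarrow>
      isord g \<and> g \<noteq> ozero \<and> (node \<alpha> l c = ozero \<or> olt g (node \<alpha> l c))"
  shows "gate_at \<alpha> l c \<longleftrightarrow> (\<forall>g\<in>children p x \<alpha> l c. \<not> gate x (inv ord_of g))"
proof -
  let ?n = "inv ord_of (node \<alpha> l c)"
  have n: "ord_of ?n = node \<alpha> l c" using \<alpha> by simp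
  have n0: "?n = 0 \<longleftrightarrow> node \<alpha> l c = ozero" using n ord_of_eq_ozero by metis
  have child: "child_of p x m ?n \<longleftrightarrow> ord_of m \<in> children p x \<alpha> l c" for m
    by (simp add: child_of_def n)
  have "gate_at \<alpha> l c \<longleftrightarrow> (\<forall>m. ord_of m \<in> children p x \<alpha> l c \<longrightarrow> \<not> gate x m)"
    unfolding gate_at_def gate.simps[of x ?n] x child
    using below n n0 unfolding below_def by (metis ord_of_eq_ozero)
  also have "\<dots> \<longleftrightarrow> (\<forall>g\<in>children p x \<alpha> l c. \<not> gate x (inv ord_of g))"
    using below by (metis inv_ord_of ord_of_inv)
  finally show ?thesis .
qed

lemma gate_at_true: "gate_at ozero 1 0"
proof -
  have "children p x ozero 1 0 = {}" by (simp add: children_def)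
  then show ?thesis using gate_at_eq[of ozero 1 0] by simp
qed

lemma gate_at_neg: "isord \<alpha> \<Longrightarrow> gate_at \<alpha> 4 c \<longleftrightarrow> \<not> gate_at \<alpha> 3 c"
proof -
  assume \<alpha>: "isord \<alpha>"
  have "children p x \<alpha> 4 c = {node \<alpha> 3 c}" by (simp add: children_def)
  then have "gate_at \<alpha> 4 c \<longleftrightarrow> \<not> gate x (inv ord_of (node \<alpha> 3 c))"
    using gate_at_eq[OF \<alpha>, of 4 c] \<alpha> by (simp add: node_neq_ozero olt_node)
  then show ?thesis by (simp add: gate_at_def)
qed

lemma gate_at_initial: "gate_at ozero 3 (prod_encode it) \<longleftrightarrow> cval (initial x) it"
proof -
  have ch: "children p x ozero 3 (prod_encode it) =
      (if cval (initial x) it then {} else {node ozero 1 0})"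
    by (simp add: children_def)
  have "gate_at ozero 3 (prod_encode it) \<longleftrightarrow>
      (\<forall>g\<in>children p x ozero 3 (prod_encode it). \<not> gate x (inv ord_of g))"
    by (rule gate_at_eq) (simp_all add: ch node_neq_ozero olt_node split: if_splits)
  then show ?thesis using gate_at_true unfolding ch gate_at_def by simp
qed

text \<open>An auxiliary gate is true iff its view is the actual one: its inputs are the negated
  literals. The item gate excludes every view with a negative outcome, and exactly one view is
  actual.\<close>

lemma gate_at_successor:
  assumes \<gamma>: "isord \<gamma>" and IH: "\<And>it. gate_at \<gamma> 3 (prod_encode it) \<longleftrightarrow> cval c it"
  shows "gate_at (osuc \<gamma>) 3 (prod_encode it) \<longleftrightarrow> cval (step p c) it"
proof -
  have pred: "(osuc \<gamma>)(0 := osuc \<gamma> 0 - 1) = \<gamma>" by (auto simp: osuc_def)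
  have view: "gate_at (osuc \<gamma>) 2 (to_nat (it, w)) \<longleftrightarrow> w = view c it" for w :: view
  proof -
    have ch: "children p x (osuc \<gamma>) 2 (to_nat (it, w)) =
        {node \<gamma> (if b then 4 else 3) (prod_encode i) | i b. (i, b) \<in> literals it w}"
      using pred by (simp add: children_def)
    have "gate_at (osuc \<gamma>) 2 (to_nat (it, w)) \<longleftrightarrow>
        (\<forall>g\<in>children p x (osuc \<gamma>) 2 (to_nat (it, w)). \<not> gate x (inv ord_of g))"
      using \<gamma> by (intro gate_at_eq) (auto simp: ch node_neq_ozero intro!: olt_node olt_osuc)
    also have "\<dots> \<longleftrightarrow> (\<forall>(i, b)\<in>literals it w. \<not> gate_at \<gamma> (if b then 4 else 3) (prod_encode i))"
      unfolding ch gate_at_def by blast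
    also have "\<dots> \<longleftrightarrow> (\<forall>(i, b)\<in>literals it w. cval c i = b)"
      using gate_at_neg[OF \<gamma>] IH by (intro ball_cong) auto
    finally show ?thesis by (simp only: literals_view)
  qed
  have ch: "children p x (osuc \<gamma>) 3 (prod_encode it) =
      {node (osuc \<gamma>) 2 (to_nat (it, w)) | w. \<not> outcome p it w}"
    by (simp add: children_def)
  have "gate_at (osuc \<gamma>) 3 (prod_encode it) \<longleftrightarrow>
      (\<forall>g\<in>children p x (osuc \<gamma>) 3 (prod_encode it). \<not> gate x (inv ord_of g))"
    using \<gamma> by (intro gate_at_eq) (auto simp: ch node_neq_ozero intro!: olt_node)
  also have "\<dots> \<longleftrightarrow> (\<forall>w. \<not> outcome p it w \<longrightarrow> \<not> gate_at (osuc \<gamma>) 2 (to_nat (it, w)))"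
    unfolding ch gate_at_def by blast
  finally show ?thesis unfolding view cval_step by blast
qed

text \<open>The limsup is a double NOR: an auxiliary gate says that the cell is 0 at all stages from
  \<open>ord_of b\<close> on, and the item gate denies this for every \<open>b\<close>. State and
  head are constants at a limit.\<close>

lemma gate_at_limit:
  assumes lim: "olimit \<alpha>"
    and IH: "\<And>\<gamma> it. isord \<gamma> \<Longrightarrow> olt \<gamma> \<alpha> \<Longrightarrow> gate_at \<gamma> 3 (prod_encode it) \<longleftrightarrow> cval (r \<gamma>) it"
  shows "gate_at \<alpha> 3 (prod_encode it) \<longleftrightarrow> cval (limit_config r \<alpha>) it"
proof -
  have \<alpha>: "isord \<alpha>" "\<alpha> 0 = 0" "\<alpha> \<noteq> ozero" using lim by (auto simp: olimit_def)
  obtain t j where it: "it = (t, j)" by (cases it)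
  show ?thesis
  proof (cases "t < 2")
    case True
    then have ch: "children p x \<alpha> 3 (prod_encode it) =
        (if it = (0, q_limit) \<or> it = (1, 0) then {} else {node ozero 1 0})"
      using \<alpha> it by (simp add: children_def)
    have "gate_at \<alpha> 3 (prod_encode it) \<longleftrightarrow>
        (\<forall>g\<in>children p x \<alpha> 3 (prod_encode it). \<not> gate x (inv ord_of g))"
      using \<alpha> olt_ozero_olimit[OF lim]
      by (intro gate_at_eq) (auto simp: ch node_neq_ozero intro!: olt_node split: if_splits)
    also have "\<dots> \<longleftrightarrow> it = (0, q_limit) \<or> it = (1, 0)"
      using gate_at_true unfolding ch gate_at_def by auto
    also have "\<dots> \<longleftrightarrow> cval (limit_config r \<alpha>) it"
      using True it by (auto simp: cval_def limit_config_def cstate_def chead_def)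
    finally show ?thesis .
  next
    case False
    have zero: "gate_at \<alpha> 2 (to_nat (it, b)) \<longleftrightarrow>
        \<not> (\<exists>\<gamma>. isord \<gamma> \<and> \<not> olt \<gamma> (ord_of b) \<and> olt \<gamma> \<alpha> \<and> cval (r \<gamma>) it)" for b :: nat
    proof -
      have ch: "children p x \<alpha> 2 (to_nat (it, b)) =
          {node \<gamma> 3 (prod_encode it) | \<gamma>. isord \<gamma> \<and> \<not> olt \<gamma> (ord_of b) \<and> olt \<gamma> \<alpha>}"
        using \<alpha> by (simp add: children_def)
      have "gate_at \<alpha> 2 (to_nat (it, b)) \<longleftrightarrow>
          (\<forall>g\<in>children p x \<alpha> 2 (to_nat (it, b)). \<not> gate x (inv ord_of g))"
        using \<alpha> by (intro gate_at_eq) (auto simp: ch node_neq_ozero intro!: olt_node)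
      also have "\<dots> \<longleftrightarrow> (\<forall>\<gamma>. isord \<gamma> \<and> \<not> olt \<gamma> (ord_of b) \<and> olt \<gamma> \<alpha> \<longrightarrow>
          \<not> gate_at \<gamma> 3 (prod_encode it))"
        unfolding ch gate_at_def by blast
      finally show ?thesis using IH by blast
    qed
    have ch: "children p x \<alpha> 3 (prod_encode it) = {node \<alpha> 2 (to_nat (it, b)) | b. olt (ord_of b) \<alpha>}"
      using \<alpha> it False by (simp add: children_def)
    have "gate_at \<alpha> 3 (prod_encode it) \<longleftrightarrow>
        (\<forall>g\<in>children p x \<alpha> 3 (prod_encode it). \<not> gate x (inv ord_of g))"
      using \<alpha> by (intro gate_at_eq) (auto simp: ch node_neq_ozero intro!: olt_node)
    also have "\<dots> \<longleftrightarrow> (\<forall>b. olt (ord_of b) \<alpha> \<longrightarrow> \<not> gate_at \<alpha> 2 (to_nat (it, b)))"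
      unfolding ch gate_at_def by blast
    \<comment> \<open>Every ordinal below \<alpha> is denoted by some \<open>b\<close>, so all
      starting points are covered.\<close>
    also have "\<dots> \<longleftrightarrow> olimsup (\<lambda>\<gamma>. cval (r \<gamma>) it) \<alpha>"
      unfolding zero olimsup_def using ord_of_surj isord_ord_of by metis
    also have "\<dots> \<longleftrightarrow> cval (limit_config r \<alpha>) it"
      using False it by (auto simp: cval_def limit_config_def ctape1_def ctape2_def ctape3_def)
    finally show ?thesis .
  qed
qed

lemma gate_at_run:
  assumes run: "is_run p x r \<alpha>" and "isord \<beta>" "olt \<beta> \<alpha> \<or> \<beta> = \<alpha>"
  shows "gate_at \<beta> 3 (prod_encode it) \<longleftrightarrow> cval (r \<beta>) it"
  using assms(2,3)
proof (induction \<beta> arbitrary: it rule: olt_induct)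
  case (less \<beta>)
  have below: "gate_at \<gamma> 3 (prod_encode it) \<longleftrightarrow> cval (r \<gamma>) it" if "isord \<gamma>" "olt \<gamma> \<beta>" for \<gamma> it
    using less.IH[OF that] less.prems that(2) olt_trans by blast
  have r: "\<beta> = ozero \<Longrightarrow> r \<beta> = initial x" "\<And>\<gamma>. isord \<gamma> \<Longrightarrow> \<beta> = osuc \<gamma> \<Longrightarrow> r \<beta> = step p (r \<gamma>)"
    "olimit \<beta> \<Longrightarrow> r \<beta> = limit_config r \<beta>"
    using run less unfolding is_run_def by blast+
  show ?case
  proof (cases rule: ordw_cases[OF \<open>isord \<beta>\<close>])
    case 1
    then show ?thesis using r(1) gate_at_initial by simp
  next
    case (2 \<gamma>)
    then show ?thesis using r(2) gate_at_successor[OF 2(2) below] olt_osuc by simp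
  next
    case 3
    then show ?thesis using r(3) gate_at_limit[OF 3 below] by simp
  qed
qed

text \<open>The circuit goes on after the machine has halted, at stages about which the run says
  nothing. Acceptance there is blocked by the condition that no earlier stage has halted, so the
  gate of the halting stage is the only acceptance gate that can be true.\<close>

lemma gate_root:
  assumes run: "is_run p x r \<alpha>" and \<alpha>: "isord \<alpha>" and halt: "cstate (r \<alpha>) = q_halt"
  shows "gate x 0 \<longleftrightarrow> \<not> ctape3 (r \<alpha>) 0"
proof -
  have accept: "gate_at \<beta> 5 0 \<longleftrightarrow> gate_at \<beta> 3 (prod_encode (0, q_halt)) \<and> gate_at \<beta> 3 (prod_encode (4, 0)) \<and>
      (\<forall>\<gamma>. isord \<gamma> \<and> olt \<gamma> \<beta> \<longrightarrow> \<not> gate_at \<gamma> 3 (prod_encode (0, q_halt)))" if "isord \<beta>" for \<beta>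
  proof -
    have ch: "children p x \<beta> 5 0 =
       {node \<beta> 4 (prod_encode (0, q_halt)), node \<beta> 4 (prod_encode (4, 0))} \<union>
       {node \<gamma> 3 (prod_encode (0, q_halt)) | \<gamma>. isord \<gamma> \<and> olt \<gamma> \<beta>}"
      by (simp add: children_def)
    have "gate_at \<beta> 5 0 \<longleftrightarrow> (\<forall>g\<in>children p x \<beta> 5 0. \<not> gate x (inv ord_of g))"
      using that by (intro gate_at_eq) (auto simp: ch node_neq_ozero intro!: olt_node)
    also have "\<dots> \<longleftrightarrow> \<not> gate_at \<beta> 4 (prod_encode (0, q_halt)) \<and> \<not> gate_at \<beta> 4 (prod_encode (4, 0)) \<and>
      (\<forall>\<gamma>. isord \<gamma> \<and> olt \<gamma> \<beta> \<longrightarrow> \<not> gate_at \<gamma> 3 (prod_encode (0, q_halt)))"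
      unfolding ch gate_at_def by blast
    finally show ?thesis using gate_at_neg[OF that] by simp
  qed
  have halted: "gate_at \<beta> 3 (prod_encode (0, q_halt)) \<longleftrightarrow> \<beta> = \<alpha>" if "isord \<beta>" "olt \<beta> \<alpha> \<or> \<beta> = \<alpha>" for \<beta>
    using gate_at_run[OF run that] halt is_run_not_halted[OF run that(1)] that(2)
    by (auto simp: cval_def)
  have out: "gate_at \<alpha> 3 (prod_encode (4, 0)) \<longleftrightarrow> ctape3 (r \<alpha>) 0"
    using gate_at_run[OF run \<alpha>] by (simp add: cval_def)
  have "gate_at \<alpha> 5 0 \<longleftrightarrow> ctape3 (r \<alpha>) 0"
    using accept[OF \<alpha>] halted out \<alpha> olt_irrefl by blast
  moreover have "\<beta> = \<alpha>" if "gate_at \<beta> 5 0" "isord \<beta>" for \<beta>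
    using olt_linear[OF \<open>isord \<beta>\<close> \<alpha>] accept[OF \<open>isord \<beta>\<close>] halted that \<alpha> by blast
  moreover have "gate x 0 \<longleftrightarrow> (\<forall>\<beta>. isord \<beta> \<longrightarrow> \<not> gate_at \<beta> 5 0)"
  proof -
    have ch: "children p x ozero 0 0 = {node \<beta> 5 0 | \<beta>. isord \<beta>}" by (simp add: children_def)
    have "inv ord_of ozero = 0" using inv_ord_of[of 0] by simp
    then have "gate x 0 \<longleftrightarrow> gate_at ozero 0 0" by (simp add: gate_at_def node_ozero)
    also have "\<dots> \<longleftrightarrow> (\<forall>g\<in>children p x ozero 0 0. \<not> gate x (inv ord_of g))"
      by (intro gate_at_eq) (auto simp: ch node_neq_ozero node_ozero)
    finally show ?thesis unfolding ch gate_at_def by blast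
  qed
  ultimately show ?thesis using \<alpha> by blast
qed

end

text \<open>The two admissible outputs differ in cell 0, so looking at this cell is enough for the
  circuit to contradict the machine.\<close>

lemma gates_not_decidable: "\<not> decides p {x. gate x 0}"
proof
  assume d: "decides p {x. gate x 0}"
  obtain x where x: "\<And>m n. x (5 * prod_encode (m, n)) = child_of p x m n"
    using self_reading_circuit by blast
  have root: "gate x 0 \<longleftrightarrow> \<not> ctape3 c 0" if "halts_at p x \<alpha> c" for \<alpha> c
    using that gate_root[OF x] unfolding halts_at_def by blast
  show False
  proof (cases "gate x 0")
    case True
    then have "accepts p x" using d by (simp add: decides_def)
    then obtain \<alpha> c where "halts_at p x \<alpha> c" "ctape3 c = yes_real" unfolding accepts_def by blast
    then show False using True root[of \<alpha> c] by (simp add: yes_real_def)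
  next
    case False
    then have "rejects p x" using d by (simp add: decides_def)
    then obtain \<alpha> c where "halts_at p x \<alpha> c" "ctape3 c = no_real" unfolding rejects_def by blast
    then show False using False root[of \<alpha> c] by (simp add: no_real_def)
  qed
qed

lemma gates_in_NP: "{x. gate x 0 = v} \<in> class_NP"
proof -
  have "x \<in> {x. gate x 0 = v} \<longleftrightarrow> (\<exists>y. accepts (tm (verifier v)) (pair_real x y))" for x
    by (simp add: accepts_verifier certificate_gate)
  then show ?thesis
    unfolding class_NP_def using wf_tm[OF ok_verifier] tm_correct(1)[OF ok_verifier] by blast
qed

theorem mainTheorem4:
  shows "class_P \<noteq> class_NP \<inter> class_coNP \<and> class_P \<noteq> class_NP"
proof -
  let ?A = "{x. gate x 0}"
  have "?A \<in> class_NP" using gates_in_NP[of True] by simp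
  moreover have "{x. \<not> gate x 0} \<in> class_NP" using gates_in_NP[of False] by simp
  moreover have "?A = UNIV - {x. \<not> gate x 0}" by auto
  ultimately have "?A \<in> class_NP \<inter> class_coNP" unfolding class_coNP_def by blast
  moreover have "?A \<notin> class_P" using gates_not_decidable by (auto simp: class_P_def)
  ultimately show ?thesis by blast
qed

end
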